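(* Let $\beta>1$ and $0<\zeta/\alpha<2$. Let $u$ be a vertex of $\mathcal{G}(N;\zeta,\alpha,\beta)$ and $D_u$ its degree. Then, as $N\to\infty$, $$D_u \xrightarrow{d} \mathsf{MP}(F),$$ where $\mathsf{MP}(F)$ is a mixed Poisson random variable with mixing distribution function $F$ given by $F(t)=1-\left(\frac{K}{t}\right)^{2\alpha/\zeta}$ for $t\ge K$ and $F(t)=0$ for $t<K$, with $$K=\frac{4\alpha}{2\alpha-\zeta}\cdot\frac{1}{\beta}\cdot\frac{1}{\sin(\pi/\beta)}.$$ In particular, as $k$ and $N$ grow, $$\Pr[D_u=k]=\frac{2\alpha}{\zeta}K^{2\alpha/\zeta}k^{-(2\alpha/\zeta+1)}+o(1),$$ i.e. the degree of $u$ follows a power law with exponent $2\alpha/\zeta+1$.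
   Context: Model $\mathcal{G}(N;\zeta,\alpha,\beta)$: fix $0<\zeta<2$, $\alpha>0$, $\beta>0$. For a positive integer $N$ let $R$ be defined by $N=e^{\zeta R/2}$. Work in the native representation of the hyperbolic plane of curvature $-\zeta^2$: points of $\mathbb{R}^2$ in polar coordinates $(r,\theta)$, where $r$ is the hyperbolic distance from the origin, and the hyperbolic distance $d(u,v)$ between $u=(r_u,\theta_u)$ and $v=(r_v,\theta_v)$ is given by $\cosh(\zeta d(u,v))=\cosh(\zeta r_u)\cosh(\zeta r_v)-\sinh(\zeta r_u)\sinh(\zeta r_v)\cos(\theta_{u,v})$, with $\theta_{u,v}\in[0,\pi]$ the relative angle between $u$ and $v$. The vertex set consists of $N$ independent random points in the disc $\mathcal{D}_R$ of radius $R$ about the origin, each with angle uniform on $(0,2\pi]$ and, independently, radius with density $\rho(r)=\alpha\frac{\sinh(\alpha r)}{\cosh(\alpha R)-1}$ on $[0,R]$. Given the positions, each pair of distinct vertices $u,v$ is joined independently with probability $p_{u,v}=\frac{1}{\exp\left(\beta\frac{\zeta}{2}(d(u,v)-R)\right)+1}$. A mixed Poisson variable $\mathsf{MP}(F)$ satisfies $\Pr[\mathsf{MP}(F)=k]=\int e^{-t}\frac{t^k}{k!}\,dF(t)$. *)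

theory Defs
  imports "HOL-Probability.Probability" "HOL-Library.Landau_Symbols"
begin

(* Throughout, a point of the disc is a pair (r, \<theta>) of native polar coordinates. *)

definition disc_radius :: "real \<Rightarrow> nat \<Rightarrow> real" where
  "disc_radius \<zeta> N = 2 / \<zeta> * ln (real N)"

lemma exp_disc_radius:
  assumes "0 < \<zeta>" and "1 \<le> N"
  shows "real N = exp (\<zeta> * disc_radius \<zeta> N / 2)"
  using assms by (simp add: disc_radius_def)

definition relative_angle :: "real \<times> real \<Rightarrow> real \<times> real \<Rightarrow> real" where
  "relative_angle p q = (let \<delta> = \<bar>snd p - snd q\<bar> in min \<delta> (2 * pi - \<delta>))"

lemma relative_angle_range:
  assumes "snd p \<in> {0<..2 * pi}" and "snd q \<in> {0<..2 * pi}"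
  shows "relative_angle p q \<in> {0..pi}"
  using assms by (auto simp: relative_angle_def Let_def min_def abs_if)

definition hyp_dist :: "real \<Rightarrow> real \<times> real \<Rightarrow> real \<times> real \<Rightarrow> real" where
  "hyp_dist \<zeta> p q =
     arcosh (cosh (\<zeta> * fst p) * cosh (\<zeta> * fst q)
             - sinh (\<zeta> * fst p) * sinh (\<zeta> * fst q) * cos (relative_angle p q)) / \<zeta>"

lemma hyp_dist:
  assumes "0 < \<zeta>" and "0 \<le> fst p" and "0 \<le> fst q"
  shows "cosh (\<zeta> * hyp_dist \<zeta> p q)
           = cosh (\<zeta> * fst p) * cosh (\<zeta> * fst q)
             - sinh (\<zeta> * fst p) * sinh (\<zeta> * fst q) * cos (relative_angle p q)" (is "_ = ?c")
    and "0 \<le> hyp_dist \<zeta> p q"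
proof -
  let ?s = "sinh (\<zeta> * fst p) * sinh (\<zeta> * fst q)"
  have "0 \<le> ?s"
    using assms by simp
  then have "?s * cos (relative_angle p q) \<le> ?s * 1"
    by (intro mult_left_mono) auto
  moreover have "1 \<le> cosh (\<zeta> * fst p - \<zeta> * fst q)"
    by (rule cosh_real_ge_1)
  ultimately have c: "1 \<le> ?c"
    by (simp add: cosh_diff)
  show "cosh (\<zeta> * hyp_dist \<zeta> p q) = ?c"
    using assms(1) c by (simp add: hyp_dist_def)
  show "0 \<le> hyp_dist \<zeta> p q"
    using assms(1) arcosh_nonneg_real[OF c] by (simp add: hyp_dist_def)
qed

definition point_law :: "real \<Rightarrow> real \<Rightarrow> (real \<times> real) measure" where
  "point_law \<alpha> R =
     density lborel (\<lambda>r. ennreal (indicator {0..R} r * (\<alpha> * sinh (\<alpha> * r) / (cosh (\<alpha> * R) - 1))))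
     \<Otimes>\<^sub>M uniform_measure lborel {0<..2 * pi}"

definition edge_prob :: "real \<Rightarrow> real \<Rightarrow> real \<Rightarrow> real \<times> real \<Rightarrow> real \<times> real \<Rightarrow> real" where
  "edge_prob \<zeta> \<beta> R p q = 1 / (exp (\<beta> * (\<zeta> / 2) * (hyp_dist \<zeta> p q - R)) + 1)"

definition vertex_pairs :: "nat \<Rightarrow> nat set set" where
  "vertex_pairs N = {e. e \<subseteq> {..<N} \<and> card e = 2}"

(* A graph on {..<N} is the indicator of its edge set, a function on two-element sets that is
   False outside vertex_pairs N.  The law of the graph is obtained by sampling the N positions
   independently and then, given the positions x, tossing an independent coin for each pair.
   For N \<le> 1 the radius is not positive and the radial density degenerates (division by zero);
   only N \<ge> 2 is meaningful. *)
definition hyp_graph :: "real \<Rightarrow> real \<Rightarrow> real \<Rightarrow> nat \<Rightarrow> (nat set \<Rightarrow> bool) measure" where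
  "hyp_graph \<zeta> \<alpha> \<beta> N =
     (\<Pi>\<^sub>M i\<in>{..<N}. point_law \<alpha> (disc_radius \<zeta> N)) \<bind>
     (\<lambda>x. measure_pmf (Pi_pmf (vertex_pairs N) False
             (\<lambda>e. bernoulli_pmf (edge_prob \<zeta> \<beta> (disc_radius \<zeta> N) (x (Min e)) (x (Max e))))))"

definition vertex_degree :: "nat \<Rightarrow> nat \<Rightarrow> (nat set \<Rightarrow> bool) \<Rightarrow> nat" where
  "vertex_degree N u g = card {v \<in> {..<N}. v \<noteq> u \<and> g {u, v}}"

(* dF is the Lebesgue-Stieltjes measure of F. *)
definition mixed_poisson :: "(real \<Rightarrow> real) \<Rightarrow> nat measure" where
  "mixed_poisson F =
     density (count_space UNIV)
       (\<lambda>k. ennreal (LINT t|interval_measure F. exp (- t) * t ^ k / fact k))"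

lemma finite_vertex_pairs: "finite (vertex_pairs N)"
  by (rule finite_subset[of _ "Pow {..<N}"]) (auto simp: vertex_pairs_def)

lemma sets_point_law [measurable_cong]: "sets (point_law \<alpha> R) = sets (borel \<Otimes>\<^sub>M borel)"
  unfolding point_law_def by (intro sets_pair_measure_cong) auto

lemma measurable_edge_prob [measurable]:
  assumes [measurable]: "f \<in> M \<rightarrow>\<^sub>M borel \<Otimes>\<^sub>M borel" "g \<in> M \<rightarrow>\<^sub>M borel \<Otimes>\<^sub>M borel"
  shows "(\<lambda>x. edge_prob \<zeta> \<beta> R (f x) (g x)) \<in> borel_measurable M"
proof -
  have [measurable]: "(cosh :: real \<Rightarrow> real) \<in> borel_measurable borel"
    "(sinh :: real \<Rightarrow> real) \<in> borel_measurable borel"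
    by (intro borel_measurable_continuous_onI continuous_intros)+
  show ?thesis
    unfolding edge_prob_def hyp_dist_def relative_angle_def Let_def arcosh_def by measurable
qed

lemma edge_prob_bounds: "0 < edge_prob \<zeta> \<beta> R p q" "edge_prob \<zeta> \<beta> R p q < 1"
  by (auto simp: edge_prob_def field_simps add_pos_pos)

lemma prob_space_point_law:
  assumes "0 < \<alpha>" and "0 < R"
  shows "prob_space (point_law \<alpha> R)"
proof -
  let ?f = "\<lambda>r. \<alpha> * sinh (\<alpha> * r) / (cosh (\<alpha> * R) - 1)"
  have c: "cosh (\<alpha> * R) > 1"
    using assms cosh_real_strict_mono[of 0 "\<alpha> * R"] by simp
  have "(\<integral>\<^sup>+r. ennreal (?f r) * indicator {0..R} r \<partial>lborel)
          = ennreal (cosh (\<alpha> * R) / (cosh (\<alpha> * R) - 1) - cosh (\<alpha> * 0) / (cosh (\<alpha> * R) - 1))"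
  proof (rule nn_integral_FTC_Icc[where F = "\<lambda>r. cosh (\<alpha> * r) / (cosh (\<alpha> * R) - 1)"])
    show "?f \<in> borel_measurable borel"
      by (intro borel_measurable_continuous_onI continuous_intros) (use c in auto)
    show "((\<lambda>r. cosh (\<alpha> * r) / (cosh (\<alpha> * R) - 1)) has_real_derivative ?f r) (at r)"
      if "r \<in> {0..R}" for r
      using assms by (auto intro!: derivative_eq_intros)
    show "0 \<le> ?f r" if "r \<in> {0..R}" for r
      using assms c that by simp
  qed (use assms in auto)
  also have "\<dots> = 1"
    using assms by (simp add: diff_divide_distrib[symmetric])
  finally have "(\<integral>\<^sup>+r. ennreal (indicator {0..R} r * ?f r) \<partial>lborel) = 1"
    by (rule back_subst[where P = "\<lambda>I. I = 1"])
       (intro nn_integral_cong, simp split: split_indicator)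
  moreover have "(\<lambda>r. ennreal (indicator {0..R} r * ?f r)) \<in> borel_measurable lborel"
  proof -
    have [measurable]: "?f \<in> borel_measurable borel"
      by (intro borel_measurable_continuous_onI continuous_intros) (use c in auto)
    show ?thesis by measurable
  qed
  ultimately have "prob_space (density lborel (\<lambda>r. ennreal (indicator {0..R} r * ?f r)))"
    by (intro prob_spaceI) (simp add: emeasure_density)
  moreover have "prob_space (uniform_measure lborel {0<..2 * pi})"
    by (rule prob_space_uniform_measure) auto
  ultimately show ?thesis
    unfolding point_law_def by (rule prob_space_pair)
qed

lemma hyp_graph_kernel:
  "(\<lambda>x. measure_pmf (Pi_pmf (vertex_pairs N) False
          (\<lambda>e. bernoulli_pmf (edge_prob \<zeta> \<beta> R (x (Min e)) (x (Max e))))))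
     \<in> (\<Pi>\<^sub>M i\<in>{..<N}. point_law \<alpha> R) \<rightarrow>\<^sub>M subprob_algebra (count_space UNIV)"
    (is "(\<lambda>x. measure_pmf (?K x)) \<in> ?P \<rightarrow>\<^sub>M _")
proof (rule measurable_subprob_algebra)
  fix A :: "(nat set \<Rightarrow> bool) set"
  let ?V = "vertex_pairs N"
  define S where "S = PiE_dflt ?V False (\<lambda>_. UNIV :: bool set)"
  have S: "finite S"
    unfolding S_def by (intro finite_PiE_dflt finite_vertex_pairs) auto
  have sub: "set_pmf (?K x) \<subseteq> S" for x
    using set_Pi_pmf_subset'[OF finite_vertex_pairs, of N False
        "\<lambda>e. bernoulli_pmf (edge_prob \<zeta> \<beta> R (x (Min e)) (x (Max e)))"]
    by (auto simp: S_def PiE_dflt_def)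
  have eq: "emeasure (measure_pmf (?K x)) A
      = ennreal (\<Sum>g\<in>A \<inter> S. \<Prod>e\<in>?V. pmf (bernoulli_pmf
          (edge_prob \<zeta> \<beta> R (x (Min e)) (x (Max e)))) (g e))" for x
  proof -
    have "emeasure (measure_pmf (?K x)) A = emeasure (measure_pmf (?K x)) (A \<inter> S)"
    proof -
      have "A \<inter> set_pmf (?K x) = (A \<inter> S) \<inter> set_pmf (?K x)"
        using sub[of x] by blast
      then show ?thesis
        using emeasure_Int_set_pmf[of "?K x" A] emeasure_Int_set_pmf[of "?K x" "A \<inter> S"] by simp
    qed
    also have "\<dots> = ennreal (\<Sum>g\<in>A \<inter> S. pmf (?K x) g)"
      using S by (simp add: measure_pmf.emeasure_eq_measure measure_measure_pmf_finite)
    also have "(\<Sum>g\<in>A \<inter> S. pmf (?K x) g) = (\<Sum>g\<in>A \<inter> S. \<Prod>e\<in>?V. pmf (bernoulli_pmf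
          (edge_prob \<zeta> \<beta> R (x (Min e)) (x (Max e)))) (g e))"
      by (intro sum.cong refl pmf_Pi' finite_vertex_pairs) (auto simp: S_def PiE_dflt_def)
    finally show ?thesis .
  qed
  have [measurable]: "(\<lambda>x. pmf (bernoulli_pmf (edge_prob \<zeta> \<beta> R (x (Min e)) (x (Max e)))) b)
      \<in> borel_measurable ?P" if "e \<in> ?V" for e b
  proof -
    have e: "finite e" "e \<noteq> {}" "e \<subseteq> {..<N}"
      using that by (auto simp: vertex_pairs_def card_eq_0_iff intro: finite_subset)
    then have "Min e \<in> {..<N}" "Max e \<in> {..<N}"
      using Min_in[OF e(1,2)] Max_in[OF e(1,2)] by blast+
    then have [measurable]: "(\<lambda>x. edge_prob \<zeta> \<beta> R (x (Min e)) (x (Max e))) \<in> borel_measurable ?P"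
      by measurable
    show ?thesis
      using edge_prob_bounds[THEN less_imp_le] by (cases b) simp_all
  qed
  show "(\<lambda>x. emeasure (measure_pmf (?K x)) A) \<in> borel_measurable ?P"
    unfolding eq by measurable
qed (auto intro: prob_space_imp_subprob_space measure_pmf.prob_space_axioms)

lemma space_point_law: "space (point_law \<alpha> R) = UNIV"
  by (simp add: point_law_def space_pair_measure)

lemma sets_hyp_graph [simp]: "sets (hyp_graph \<zeta> \<alpha> \<beta> N) = UNIV"
  unfolding hyp_graph_def
  by (subst sets_bind[where N = "count_space UNIV"]) (auto simp: space_PiM space_point_law PiE_eq_empty_iff)

lemma prob_space_hyp_graph:
  assumes "0 < \<zeta>" and "0 < \<alpha>" and "2 \<le> N"
  shows "prob_space (hyp_graph \<zeta> \<alpha> \<beta> N)"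
proof -
  have "0 < disc_radius \<zeta> N"
    using assms by (simp add: disc_radius_def)
  then interpret prob_space "\<Pi>\<^sub>M i\<in>{..<N}. point_law \<alpha> (disc_radius \<zeta> N)"
    by (intro prob_space_PiM prob_space_point_law assms)
  show ?thesis
    unfolding hyp_graph_def
    by (rule prob_space_bind[OF _ hyp_graph_kernel]) (auto intro: measure_pmf.prob_space_axioms)
qed

end

theory Submission
  imports Defs "HOL-Real_Asymp.Real_Asymp"
begin

text \<open>
  Given the position \<open>y\<close> of \<open>u\<close>, the edges at \<open>u\<close> are independent and all present with the same
  probability \<open>q(y)\<close>, so \<open>D\<^sub>u\<close> is a mixture of binomial variables with \<open>N - 1\<close> trials. The law of
  cosines in the form \<open>cosh (\<zeta> d) = cosh (\<zeta> (r + r')) sin\<^sup>2 (\<phi>/2) + cosh (\<zeta> (r - r')) cos\<^sup>2 (\<phi>/2)\<close>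
  gives, for radii \<open>r = R - t\<close> and \<open>r' = R - s\<close> and an angle \<open>\<phi> = x / N\<close>, both the limit
  \<open>1 / (1 + (exp (- \<zeta> (t + s) / 2) x / 2)\<^sup>\<beta>)\<close> of the connection probability and an integrable majorant
  of the same shape. Dominated convergence in \<open>x\<close> and in \<open>s\<close>, together with
  \<open>\<integral>\<^sub>0\<^sup>\<infinity> dx / (1 + x\<^sup>\<beta>) = \<pi> / (\<beta> sin (\<pi>/\<beta>))\<close>, yields \<open>N q \<longlonglongrightarrow> K exp (\<zeta> t / 2)\<close>. Since \<open>t\<close> is
  asymptotically exponential with rate \<open>\<alpha>\<close>, the limiting mean is Pareto distributed with distribution
  function \<open>F\<close>, and the binomials become Poisson. With \<open>a = 2 \<alpha> / \<zeta>\<close>, the limit weights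
  are incomplete Gamma integrals, and \<open>\<Gamma> (k - a) / k! \<sim> k\<^bsup>- (a + 1)\<^esup>\<close> gives the power law.
\<close>

section \<open>The degree as a mixture of binomials\<close>

text \<open>The degree event splits over the possible neighbourhoods \<open>S\<close> of
  \<open>u\<close>. For fixed \<open>S\<close> it prescribes only the coins of the pairs containing
  \<open>u\<close>, so independence gives a product over the other vertices.\<close>

lemma prob_vertex_degree_coins:
  fixes p :: "nat set \<Rightarrow> real"
  assumes p: "\<And>e. 0 \<le> p e" "\<And>e. p e \<le> 1" and u: "u < N"
  shows "measure_pmf.prob (Pi_pmf (vertex_pairs N) False (\<lambda>e. bernoulli_pmf (p e)))
             {g. vertex_degree N u g = k}
           = (\<Sum>S | S \<subseteq> {..<N} - {u} \<and> card S = k.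
                \<Prod>v\<in>{..<N} - {u}. if v \<in> S then p {u, v} else 1 - p {u, v})"
proof -
  let ?K = "Pi_pmf (vertex_pairs N) False (\<lambda>e. bernoulli_pmf (p e))"
  let ?I = "{..<N} - {u}"
  let ?T = "{S. S \<subseteq> ?I \<and> card S = k}"
  define A where "A S = {g :: nat set \<Rightarrow> bool. {v \<in> {..<N}. v \<noteq> u \<and> g {u, v}} = S}" for S
  have fin: "finite ?T"
    by (rule finite_subset[of _ "Pow ?I"]) auto
  have "{g. vertex_degree N u g = k} = (\<Union>S\<in>?T. A S)"
    by (auto simp: A_def vertex_degree_def)
  then have "measure_pmf.prob ?K {g. vertex_degree N u g = k} = (\<Sum>S\<in>?T. measure_pmf.prob ?K (A S))"
    using fin by (simp, intro measure_pmf.finite_measure_finite_Union)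
      (auto simp: A_def disjoint_family_on_def)
  also have "\<dots> = (\<Sum>S\<in>?T. \<Prod>v\<in>?I. if v \<in> S then p {u, v} else 1 - p {u, v})"
  proof (rule sum.cong[OF refl])
    fix S assume S: "S \<in> ?T"
    \<comment> \<open>For \<open>e = {u, v}\<close> the proposition
      \<open>e - {u} \<subseteq> S\<close> says that \<open>v\<close> lies in \<open>S\<close>, so
      exactly one coin value is allowed; pairs avoiding \<open>u\<close> are unconstrained and
      contribute the factor 1.\<close>
    define B where "B e = (if u \<in> e then {e - {u} \<subseteq> S} else UNIV)" for e :: "nat set"
    have pairs: "bij_betw (\<lambda>v. {u, v}) ?I {e \<in> vertex_pairs N. u \<in> e}"
      unfolding bij_betw_def
    proof
      show "inj_on (\<lambda>v. {u, v}) ?I"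
        by (auto simp: inj_on_def doubleton_eq_iff)
      show "(\<lambda>v. {u, v}) ` ?I = {e \<in> vertex_pairs N. u \<in> e}"
        using u by (fastforce simp: vertex_pairs_def card_2_iff)
    qed
    have "g \<in> A S \<longleftrightarrow> g \<in> Pi (vertex_pairs N) B" for g
    proof -
      have "g \<in> Pi (vertex_pairs N) B \<longleftrightarrow> (\<forall>e\<in>{e \<in> vertex_pairs N. u \<in> e}. g e = (e - {u} \<subseteq> S))"
        by (auto simp: B_def Pi_def)
      also have "\<dots> \<longleftrightarrow> (\<forall>v\<in>?I. g {u, v} = (v \<in> S))"
        unfolding bij_betw_imp_surj_on[OF pairs, symmetric] by auto
      also have "\<dots> \<longleftrightarrow> g \<in> A S"
        using S by (auto simp: A_def)
      finally show ?thesis ..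
    qed
    then have "measure_pmf.prob ?K (A S) = measure_pmf.prob ?K (Pi (vertex_pairs N) B)"
      by (intro arg_cong[where f = "measure_pmf.prob ?K"]) blast
    also have "\<dots> = (\<Prod>e\<in>vertex_pairs N. measure_pmf.prob (bernoulli_pmf (p e)) (B e))"
      by (rule measure_Pi_pmf_Pi[OF finite_vertex_pairs])
    also have "\<dots> = (\<Prod>e\<in>{e \<in> vertex_pairs N. u \<in> e}. measure_pmf.prob (bernoulli_pmf (p e)) (B e))"
      by (rule prod.mono_neutral_right[OF finite_vertex_pairs]) (auto simp: B_def)
    also have "\<dots> = (\<Prod>v\<in>?I. measure_pmf.prob (bernoulli_pmf (p {u, v})) (B {u, v}))"
      by (rule prod.reindex_bij_betw[OF pairs, symmetric])
    also have "\<dots> = (\<Prod>v\<in>?I. if v \<in> S then p {u, v} else 1 - p {u, v})"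
      using p by (intro prod.cong refl) (auto simp: B_def measure_pmf_single)
    finally show "measure_pmf.prob ?K (A S) = (\<Prod>v\<in>?I. if v \<in> S then p {u, v} else 1 - p {u, v})" .
  qed
  finally show ?thesis .
qed

text \<open>\<open>hyp_graph\<close> presents the endpoints of a pair in the order
  \<open>Min\<close>, \<open>Max\<close>; symmetry puts the position of \<open>u\<close> first
  whatever its index.\<close>

lemma edge_prob_commute: "edge_prob \<zeta> \<beta> R p q = edge_prob \<zeta> \<beta> R q p"
  by (simp add: edge_prob_def hyp_dist_def relative_angle_def abs_minus_commute mult_ac)

text \<open>By Fubini the position of \<open>u\<close> is integrated outermost. Given it, the other
  positions are independent with a common law, so each product of coin probabilities integrates to
  \<open>k\<close> factors \<open>q y\<close> and \<open>N - 1 - k\<close> factors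
  \<open>1 - q y\<close>; the binomial coefficient counts the neighbourhoods of size
  \<open>k\<close>.\<close>

lemma emeasure_vertex_degree:
  fixes \<zeta> \<alpha> \<beta> :: real
  assumes \<zeta>: "0 < \<zeta>" and \<alpha>: "0 < \<alpha>" and N: "2 \<le> N" and u: "u < N"
  defines "M \<equiv> point_law \<alpha> (disc_radius \<zeta> N)"
  defines "q \<equiv> \<lambda>y. \<integral>z. edge_prob \<zeta> \<beta> (disc_radius \<zeta> N) y z \<partial>M"
  shows "emeasure (hyp_graph \<zeta> \<alpha> \<beta> N) {g. vertex_degree N u g = k}
           = (\<integral>\<^sup>+y. ennreal (real ((N - 1) choose k) * q y ^ k * (1 - q y) ^ (N - 1 - k)) \<partial>M)"
proof -
  define R where "R = disc_radius \<zeta> N"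
  have "0 < R"
    using \<zeta> N by (simp add: R_def disc_radius_def)
  then interpret M: prob_space M
    unfolding M_def R_def[symmetric] by (intro prob_space_point_law \<alpha>)
  interpret P: product_sigma_finite "\<lambda>_::nat. M"
    by standard
  let ?I = "{..<N} - {u}"
  let ?T = "{S. S \<subseteq> ?I \<and> card S = k}"
  have fin: "finite ?T"
    by (rule finite_subset[of _ "Pow ?I"]) auto
  have setsM[measurable_cong]: "sets M = sets (borel \<Otimes>\<^sub>M borel)"
    by (simp add: M_def sets_point_law)
  \<comment> \<open>\<open>w b y z\<close> is the probability that the coin of a pair at positions
    \<open>y\<close> and \<open>z\<close> shows \<open>b\<close>.\<close>
  define w where "w b y z = (if b then edge_prob \<zeta> \<beta> R y z else 1 - edge_prob \<zeta> \<beta> R y z)" for b y z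
  have w01: "0 \<le> w b y z" "w b y z \<le> 1" for b y z
    using edge_prob_bounds[of \<zeta> \<beta> R y z] by (auto simp: w_def)
  have w_meas[measurable]: "(\<lambda>x. w b (f x) (g x)) \<in> borel_measurable L"
    if "f \<in> L \<rightarrow>\<^sub>M borel \<Otimes>\<^sub>M borel" "g \<in> L \<rightarrow>\<^sub>M borel \<Otimes>\<^sub>M borel" for b f g and L :: "'x measure"
    using that unfolding w_def by (cases b) auto
  have int: "integrable M (w b y)" for b y
  proof (rule M.integrable_const_bound[where B = 1])
    show "w b y \<in> borel_measurable M"
      using w_meas[of "\<lambda>_. y" M "\<lambda>z. z" b] by (simp add: measurable_ident_sets[OF setsM] space_pair_measure)
  qed (auto simp: w01)
  have intE: "integrable M (edge_prob \<zeta> \<beta> R y)" for y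
    using int[of True y] by (simp add: w_def[abs_def])
  have q: "(\<integral>\<^sup>+z. ennreal (w b y z) \<partial>M) = ennreal (if b then q y else 1 - q y)" for b y
  proof -
    have "(\<integral>z. w b y z \<partial>M) = (if b then q y else 1 - q y)"
      using intE[of y] by (simp add: w_def q_def R_def M.prob_space)
    then show ?thesis
      by (subst nn_integral_eq_integral[OF int]) (auto simp: w01)
  qed
  have q01: "0 \<le> q y" "q y \<le> 1" for y
  proof -
    show "0 \<le> q y"
      unfolding q_def using edge_prob_bounds[THEN less_imp_le] by (intro integral_nonneg_AE) auto
    have "q y \<le> (\<integral>z. 1 \<partial>M)"
      unfolding q_def using intE[of y] edge_prob_bounds[THEN less_imp_le]
      by (intro integral_mono) (auto simp: w_def R_def)
    then show "q y \<le> 1" by (simp add: M.prob_space)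
  qed
  have coins: "emeasure (measure_pmf (Pi_pmf (vertex_pairs N) False
             (\<lambda>e. bernoulli_pmf (edge_prob \<zeta> \<beta> R (x (Min e)) (x (Max e)))))) {g. vertex_degree N u g = k}
      = (\<Sum>S\<in>?T. \<Prod>v\<in>?I. ennreal (w (v \<in> S) (x u) (x v)))" for x
  proof -
    define p where "p e = edge_prob \<zeta> \<beta> R (x (Min e)) (x (Max e))" for e
    have sym: "p {u, v} = edge_prob \<zeta> \<beta> R (x u) (x v)" for v
      by (auto simp: p_def min_def max_def edge_prob_commute)
    have "measure_pmf.prob (Pi_pmf (vertex_pairs N) False (\<lambda>e. bernoulli_pmf (p e)))
             {g. vertex_degree N u g = k}
        = (\<Sum>S\<in>?T. \<Prod>v\<in>?I. if v \<in> S then p {u, v} else 1 - p {u, v})"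
      by (rule prob_vertex_degree_coins[OF _ _ u]) (simp_all add: p_def edge_prob_bounds less_imp_le)
    also have "\<dots> = (\<Sum>S\<in>?T. \<Prod>v\<in>?I. w (v \<in> S) (x u) (x v))"
      unfolding sym w_def ..
    finally show ?thesis
      by (simp add: measure_pmf.emeasure_eq_measure p_def[symmetric] prod_ennreal sum_ennreal
          prod_nonneg sum_nonneg w01)
  qed
  have "emeasure (hyp_graph \<zeta> \<alpha> \<beta> N) {g. vertex_degree N u g = k}
      = (\<integral>\<^sup>+x. (\<Sum>S\<in>?T. \<Prod>v\<in>?I. ennreal (w (v \<in> S) (x u) (x v))) \<partial>(\<Pi>\<^sub>M i\<in>{..<N}. M))"
    unfolding hyp_graph_def R_def[symmetric] M_def
    by (subst emeasure_bind[OF _ hyp_graph_kernel])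
       (auto simp: coins space_PiM space_point_law PiE_eq_empty_iff)
  also have "(\<Pi>\<^sub>M i\<in>{..<N}. M) = (\<Pi>\<^sub>M i\<in>insert u ?I. M)"
    using u by (intro arg_cong2[where f = PiM]) auto
  also have "(\<integral>\<^sup>+x. (\<Sum>S\<in>?T. \<Prod>v\<in>?I. ennreal (w (v \<in> S) (x u) (x v))) \<partial>(\<Pi>\<^sub>M i\<in>insert u ?I. M))
      = (\<integral>\<^sup>+y. \<integral>\<^sup>+x. (\<Sum>S\<in>?T. \<Prod>v\<in>?I. ennreal (w (v \<in> S) ((x(u := y)) u) ((x(u := y)) v))) \<partial>(\<Pi>\<^sub>M i\<in>?I. M) \<partial>M)"
    by (rule P.product_nn_integral_insert_rev) (auto intro!: borel_measurable_sum borel_measurable_prod_ennreal)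
  also have "\<dots> = (\<integral>\<^sup>+y. \<integral>\<^sup>+x. (\<Sum>S\<in>?T. \<Prod>v\<in>?I. ennreal (w (v \<in> S) y (x v))) \<partial>(\<Pi>\<^sub>M i\<in>?I. M) \<partial>M)"
    by (intro nn_integral_cong sum.cong prod.cong) auto
  also have "\<dots> = (\<integral>\<^sup>+y. (\<Sum>S\<in>?T. \<Prod>v\<in>?I. ennreal (if v \<in> S then q y else 1 - q y)) \<partial>M)"
  proof (intro nn_integral_cong)
    fix y assume "y \<in> space M"
    have "(\<integral>\<^sup>+x. (\<Sum>S\<in>?T. \<Prod>v\<in>?I. ennreal (w (v \<in> S) y (x v))) \<partial>(\<Pi>\<^sub>M i\<in>?I. M))
        = (\<Sum>S\<in>?T. \<integral>\<^sup>+x. (\<Prod>v\<in>?I. ennreal (w (v \<in> S) y (x v))) \<partial>(\<Pi>\<^sub>M i\<in>?I. M))"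
      by (rule nn_integral_sum) (auto intro!: borel_measurable_prod_ennreal simp: space_pair_measure)
    also have "\<dots> = (\<Sum>S\<in>?T. \<Prod>v\<in>?I. ennreal (if v \<in> S then q y else 1 - q y))"
      by (intro sum.cong refl, subst P.product_nn_integral_prod)
        (use int[THEN borel_measurable_integrable] in \<open>auto simp: q\<close>)
    finally show "(\<integral>\<^sup>+x. (\<Sum>S\<in>?T. \<Prod>v\<in>?I. ennreal (w (v \<in> S) y (x v))) \<partial>(\<Pi>\<^sub>M i\<in>?I. M))
        = (\<Sum>S\<in>?T. \<Prod>v\<in>?I. ennreal (if v \<in> S then q y else 1 - q y))" .
  qed
  also have "\<dots> = (\<integral>\<^sup>+y. ennreal (real ((N - 1) choose k) * q y ^ k * (1 - q y) ^ (N - 1 - k)) \<partial>M)"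
  proof (intro nn_integral_cong)
    fix y
    have "(\<Prod>v\<in>?I. if v \<in> S then q y else 1 - q y) = q y ^ k * (1 - q y) ^ (N - 1 - k)"
      if "S \<in> ?T" for S
    proof -
      have "?I \<inter> {v. v \<in> S} = S" "?I \<inter> - {v. v \<in> S} = ?I - S" using that by auto
      then show ?thesis
        using that u finite_subset[of S ?I] by (auto simp: prod.If_cases card_Diff_subset)
    qed
    then have "(\<Sum>S\<in>?T. \<Prod>v\<in>?I. if v \<in> S then q y else 1 - q y)
        = real (card ?T) * (q y ^ k * (1 - q y) ^ (N - 1 - k))"
      by simp
    moreover have "card ?T = (N - 1) choose k"
      using u by (subst n_subsets) auto
    moreover have "(\<Sum>S\<in>?T. \<Prod>v\<in>?I. ennreal (if v \<in> S then q y else 1 - q y))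
        = ennreal (\<Sum>S\<in>?T. \<Prod>v\<in>?I. if v \<in> S then q y else 1 - q y)"
      using q01 by (simp add: prod_ennreal sum_ennreal prod_nonneg)
    ultimately show "(\<Sum>S\<in>?T. \<Prod>v\<in>?I. ennreal (if v \<in> S then q y else 1 - q y))
        = ennreal (real ((N - 1) choose k) * q y ^ k * (1 - q y) ^ (N - 1 - k))"
      by (simp add: mult_ac)
  qed
  finally show ?thesis .
qed

section \<open>The connection probability as a function of the relative angle\<close>

text \<open>The value of cosh (\<zeta> d) given by the law of cosines. Only the cosine of the angle
  enters, so \<phi> may be any real number.\<close>

definition hyp_cosh :: "real \<Rightarrow> real \<Rightarrow> real \<Rightarrow> real \<Rightarrow> real" where
  "hyp_cosh \<zeta> r r' \<phi> = cosh (\<zeta> * r) * cosh (\<zeta> * r') - sinh (\<zeta> * r) * sinh (\<zeta> * r') * cos \<phi>"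

text \<open>The angle is an unrestricted real, in contrast to \<open>relative_angle\<close>, so that
  evenness and periodicity in \<phi> can be exploited.\<close>

definition conn_prob :: "real \<Rightarrow> real \<Rightarrow> real \<Rightarrow> real \<Rightarrow> real \<Rightarrow> real \<Rightarrow> real" where
  "conn_prob \<zeta> \<beta> R r r' \<phi> = 1 / (exp (\<beta> * (\<zeta> / 2) * (arcosh (hyp_cosh \<zeta> r r' \<phi>) / \<zeta> - R)) + 1)"

text \<open>The minimum in \<open>relative_angle\<close> amounts to reflecting the angle difference
  or shifting it by a full turn, neither of which changes the cosine.\<close>

lemma edge_prob_eq_conn_prob:
  "edge_prob \<zeta> \<beta> R (r, \<theta>) (r', \<theta>') = conn_prob \<zeta> \<beta> R r r' (\<theta> - \<theta>')"
proof -
  have "cos (relative_angle (r, \<theta>) (r', \<theta>')) = cos (\<theta> - \<theta>')"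
    by (simp add: relative_angle_def Let_def min_def cos_diff)
  then show ?thesis
    by (simp add: edge_prob_def hyp_dist_def conn_prob_def hyp_cosh_def)
qed

lemma conn_prob_minus: "conn_prob \<zeta> \<beta> R r r' (- \<phi>) = conn_prob \<zeta> \<beta> R r r' \<phi>"
  by (simp add: conn_prob_def hyp_cosh_def)

lemma conn_prob_periodic: "conn_prob \<zeta> \<beta> R r r' (\<phi> + 2 * pi) = conn_prob \<zeta> \<beta> R r r' \<phi>"
  by (simp add: conn_prob_def hyp_cosh_def)

lemma measurable_conn_prob [measurable]:
  assumes [measurable]: "r \<in> borel_measurable M" "r' \<in> borel_measurable M" "\<phi> \<in> borel_measurable M"
  shows "(\<lambda>x. conn_prob \<zeta> \<beta> R (r x) (r' x) (\<phi> x)) \<in> borel_measurable M"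
proof -
  have [measurable]: "(cosh :: real \<Rightarrow> real) \<in> borel_measurable borel"
    "(sinh :: real \<Rightarrow> real) \<in> borel_measurable borel"
    by (intro borel_measurable_continuous_onI continuous_intros)+
  show ?thesis
    unfolding conn_prob_def hyp_cosh_def arcosh_def by measurable
qed

section \<open>Integrals of even periodic functions over the circle\<close>

lemma nn_integral_lborel_shift:
  fixes f :: "real \<Rightarrow> ennreal"
  assumes "f \<in> borel_measurable borel"
  shows "(\<integral>\<^sup>+x. f (x + a) \<partial>lborel) = (\<integral>\<^sup>+x. f x \<partial>lborel)"
  using nn_integral_real_affine[OF assms, of 1 a] by (simp add: add.commute)

lemma nn_integral_lborel_reflect:
  fixes f :: "real \<Rightarrow> ennreal"
  assumes "f \<in> borel_measurable borel"
  shows "(\<integral>\<^sup>+x. f (a - x) \<partial>lborel) = (\<integral>\<^sup>+x. f x \<partial>lborel)"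
  using nn_integral_real_affine[OF assms, of "-1" a] by simp

lemma nn_integral_Icc_split:
  fixes f :: "real \<Rightarrow> ennreal"
  assumes [measurable]: "f \<in> borel_measurable borel" and "a \<le> b" "b \<le> c"
  shows "(\<integral>\<^sup>+x. f x * indicator {a..c} x \<partial>lborel)
           = (\<integral>\<^sup>+x. f x * indicator {a..b} x \<partial>lborel) + (\<integral>\<^sup>+x. f x * indicator {b..c} x \<partial>lborel)"
proof -
  have "AE x in lborel. x \<noteq> b"
    by (rule AE_lborel_singleton)
  then have "(\<integral>\<^sup>+x. f x * indicator {a..c} x \<partial>lborel)
      = (\<integral>\<^sup>+x. f x * indicator {a..b} x + f x * indicator {b..c} x \<partial>lborel)"
    using assms by (intro nn_integral_cong_AE) (auto split: split_indicator)
  then show ?thesis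
    by (simp add: nn_integral_add)
qed

text \<open>A full period may be moved to start at 0, which removes \<theta>, and evenness makes the
  two half periods equal. Applied to \<open>conn_prob\<close>, this is the rotation invariance of
  the model.\<close>

lemma nn_integral_even_periodic:
  fixes f :: "real \<Rightarrow> ennreal"
  assumes f[measurable]: "f \<in> borel_measurable borel"
    and even: "\<And>x. f (- x) = f x" and periodic: "\<And>x. f (x + 2 * pi) = f x"
    and \<theta>: "0 \<le> \<theta>" "\<theta> \<le> 2 * pi"
  shows "(\<integral>\<^sup>+x. f (\<theta> - x) * indicator {0<..2 * pi} x \<partial>lborel)
           = 2 * (\<integral>\<^sup>+x. f x * indicator {0..pi} x \<partial>lborel)"
proof -
  let ?J = "\<lambda>a b. \<integral>\<^sup>+x. f x * indicator {a..b} x \<partial>lborel"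
  have refl: "?J (a - d) (a - c) = (\<integral>\<^sup>+x. f (a - x) * indicator {c..d} x \<partial>lborel)" for a c d
    by (subst nn_integral_lborel_reflect[of "\<lambda>x. f x * indicator {a - d..a - c} x" a, symmetric])
       (auto intro!: nn_integral_cong split: split_indicator)
  have shift: "?J (c + 2 * pi) (d + 2 * pi) = ?J c d" for c d
    by (subst nn_integral_lborel_shift[of "\<lambda>x. f x * indicator {c + 2 * pi..d + 2 * pi} x" "2 * pi", symmetric])
       (auto intro!: nn_integral_cong simp: periodic split: split_indicator)
  have "AE x in lborel. x \<noteq> (0::real)"
    by (rule AE_lborel_singleton)
  then have "(\<integral>\<^sup>+x. f (\<theta> - x) * indicator {0<..2 * pi} x \<partial>lborel)
      = (\<integral>\<^sup>+x. f (\<theta> - x) * indicator {0..2 * pi} x \<partial>lborel)"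
    by (intro nn_integral_cong_AE) (auto split: split_indicator)
  moreover have "(\<integral>\<^sup>+x. f (\<theta> - x) * indicator {0..2 * pi} x \<partial>lborel) = ?J (\<theta> - 2 * pi) \<theta>"
    using refl[of \<theta> "2 * pi" 0] by simp
  moreover have "?J (\<theta> - 2 * pi) \<theta> = ?J (\<theta> - 2 * pi) 0 + ?J 0 \<theta>"
    using \<theta> by (intro nn_integral_Icc_split f) auto
  moreover have "?J (\<theta> - 2 * pi) 0 = ?J \<theta> (2 * pi)"
    using shift[of "\<theta> - 2 * pi" 0] by simp
  moreover have "?J 0 (2 * pi) = ?J 0 \<theta> + ?J \<theta> (2 * pi)"
    by (rule nn_integral_Icc_split[OF f \<theta>])
  moreover have "?J 0 (2 * pi) = ?J 0 pi + ?J pi (2 * pi)"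
    by (intro nn_integral_Icc_split f) auto
  moreover have "?J pi (2 * pi) = ?J (- pi) 0"
    using shift[of "- pi" 0] by simp
  moreover have "?J (- pi) 0 = ?J 0 pi"
    using refl[of 0 pi 0] by (simp add: even)
  ultimately show ?thesis
    by (metis add.commute mult_2)
qed

lemma hyp_cosh_eq:
  "hyp_cosh \<zeta> r r' \<phi> = cosh (\<zeta> * (r + r')) * (sin (\<phi> / 2))\<^sup>2 + cosh (\<zeta> * (r - r')) * (cos (\<phi> / 2))\<^sup>2"
proof -
  define a where "a = \<phi> / 2"
  have \<phi>: "\<phi> = 2 * a" by (simp add: a_def)
  have c: "cos \<phi> = (cos a)\<^sup>2 - (sin a)\<^sup>2" unfolding \<phi> by (rule cos_double)
  have one: "(cos a)\<^sup>2 = 1 - (sin a)\<^sup>2" by (simp add: cos_squared_eq)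
  show ?thesis
    unfolding hyp_cosh_def a_def[symmetric] c one
    by (simp add: cosh_add cosh_diff algebra_simps)
qed

lemma hyp_cosh_ge_1: "1 \<le> hyp_cosh \<zeta> r r' \<phi>"
proof -
  have "1 = 1 * (sin (\<phi> / 2))\<^sup>2 + 1 * (cos (\<phi> / 2))\<^sup>2" by simp
  also have "\<dots> \<le> hyp_cosh \<zeta> r r' \<phi>"
    unfolding hyp_cosh_eq by (intro add_mono mult_right_mono cosh_real_ge_1) auto
  finally show ?thesis .
qed

lemma exp_arcosh_real:
  assumes "1 \<le> (x::real)"
  shows "exp (arcosh x) = x + sqrt (x\<^sup>2 - 1)"
proof -
  have "0 \<le> x\<^sup>2 - 1" using assms by simp
  then have "0 < x + sqrt (x\<^sup>2 - 1)" using assms by (simp add: add_pos_nonneg)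
  then show ?thesis using assms by (simp add: arcosh_real_def)
qed

text \<open>As \<open>exp (\<zeta> * disc_radius \<zeta> N)\<close> equals N^2, the exponential in
  the connection probability is the power \<beta> / 2 of exp (\<zeta> d) / N^2.\<close>

lemma conn_prob_powr:
  assumes "0 < \<zeta>" "0 < N"
  shows "conn_prob \<zeta> \<beta> (disc_radius \<zeta> N) r r' \<phi>
           = 1 / (1 + (exp (arcosh (hyp_cosh \<zeta> r r' \<phi>)) / real N ^ 2) powr (\<beta> / 2))"
proof -
  have "exp (\<beta> * (\<zeta> / 2) * (x / \<zeta> - disc_radius \<zeta> N)) = (exp x / real N ^ 2) powr (\<beta> / 2)" for x
  proof -
    have "ln (exp x / real N ^ 2) = x - 2 * ln (real N)"
      using assms by (simp add: ln_div ln_realpow)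
    then have "(exp x / real N ^ 2) powr (\<beta> / 2) = exp (\<beta> / 2 * (x - 2 * ln (real N)))"
      using assms by (simp add: powr_def)
    then show ?thesis
      using assms by (simp add: disc_radius_def algebra_simps)
  qed
  then show ?thesis
    by (simp add: conn_prob_def add.commute)
qed

section \<open>The integral of 1 / (1 + x^\<beta>) over the half-line\<close>

lemma Beta_one_minus_real:
  fixes x :: real
  assumes "0 < x" "x < 1"
  shows "Beta (1 - x) x = pi / sin (pi * x)"
proof -
  have "complex_of_real (Gamma x * Gamma (1 - x)) = Gamma (of_real x) * Gamma (1 - of_real x)"
    using Gamma_complex_of_real[of x] Gamma_complex_of_real[of "1 - x"] by simp
  also have "\<dots> = complex_of_real (pi / sin (pi * x))"
    by (subst Gamma_reflection_complex)
       (simp only: of_real_divide of_real_mult sin_of_real[symmetric])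
  finally have "Gamma x * Gamma (1 - x) = pi / sin (pi * x)"
    using of_real_eq_iff by blast
  then show ?thesis
    by (simp add: Beta_def mult.commute)
qed

text \<open>The substitution y = 1 / (1 + x^\<beta>) maps the positive half-line onto (0, 1) and
  produces the Beta integral with parameters 1 - 1 / \<beta> and 1 / \<beta>, divided by \<beta>.
  Euler's reflection formula evaluates it.\<close>

lemma nn_integral_one_plus_powr:
  fixes \<beta> :: real
  assumes \<beta>: "1 < \<beta>"
  shows "(\<integral>\<^sup>+x. ennreal (1 / (1 + x powr \<beta>)) * indicator {0<..} x \<partial>lborel)
           = ennreal (pi / (\<beta> * sin (pi / \<beta>)))"
proof -
  define g where "g = (\<lambda>x::real. 1 / (1 + x powr \<beta>))"
  define g' where "g' = (\<lambda>x::real. - (\<beta> * x powr (\<beta> - 1)) / (1 + x powr \<beta>) ^ 2)"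
  define f where "f = (\<lambda>y::real. (y powr (1 - 1 / \<beta> - 1) * (1 - y) powr (1 / \<beta> - 1)) / \<beta>)"
  define B where "B = pi / (\<beta> * sin (pi / \<beta>))"
  have img: "g ` {0<..} = {0<..<1}"
  proof (intro equalityI subsetI)
    fix y assume y: "y \<in> {0<..<1::real}"
    then have "y = g ((1 / y - 1) powr (1 / \<beta>))"
      using \<beta> by (simp add: g_def powr_powr field_simps)
    moreover have "(1 / y - 1) powr (1 / \<beta>) > 0"
      using y by simp
    ultimately show "y \<in> g ` {0<..}" by blast
  qed (auto simp: g_def add_pos_nonneg)
  have der: "(g has_field_derivative g' x) (at x within {0<..})" if "x \<in> {0<..}" for x
  proof -
    have "x > 0" "1 + x powr \<beta> \<noteq> 0" using that by (auto simp: add_nonneg_eq_0_iff)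
    then have "(g has_field_derivative g' x) (at x)"
      unfolding g_def g'_def
      by (auto intro!: derivative_eq_intros simp: power2_eq_square)
    then show ?thesis by (rule has_field_derivative_at_within)
  qed
  have inj: "inj_on g {0<..}"
    by (rule inj_on_inverseI[where g = "\<lambda>y. (1 / y - 1) powr (1 / \<beta>)"])
       (use \<beta> in \<open>auto simp: g_def powr_powr\<close>)
  have fB: "(f has_integral B) {0<..<1}"
  proof -
    have "((\<lambda>y. (y powr (1 - 1 / \<beta> - 1) * (1 - y) powr (1 / \<beta> - 1))) has_integral Beta (1 - 1 / \<beta>) (1 / \<beta>)) {0..1}"
      using \<beta> by (intro has_integral_Beta_real) auto
    from has_integral_divide[OF this, of \<beta>] show ?thesis
      using \<beta> by (simp add: has_integral_Icc_iff_Ioo f_def B_def Beta_one_minus_real mult.commute)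
  qed
  have f_nonneg: "f y \<ge> 0" for y using \<beta> by (simp add: f_def)
  have "f absolutely_integrable_on {0<..<1} \<and> integral {0<..<1} f = B"
    using fB f_nonneg by (auto intro: nonnegative_absolutely_integrable_1)
  then have *: "(\<lambda>x. \<bar>g' x\<bar> * f (g x)) absolutely_integrable_on {0<..} \<and>
      integral {0<..} (\<lambda>x. \<bar>g' x\<bar> * f (g x)) = B"
    unfolding img[symmetric] by (subst has_absolute_integral_change_of_variables_1'[OF _ der inj]) auto
  \<comment> \<open>With z = 1 + x^\<beta> one has y = 1 / z and 1 - y = x^\<beta> / z. The powers
    of x cancel and those of z combine to 1 / z, the original integrand.\<close>
  have eq: "\<bar>g' x\<bar> * f (g x) = g x" if "x \<in> {0<..}" for x
  proof -
    have x: "x > 0" using that by simp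
    define z where "z = 1 + x powr \<beta>"
    have "z > 0"
      using x by (simp add: z_def add_pos_nonneg)
    then have z: "z > 0" "1 - 1 / z = x powr \<beta> / z"
      by (auto simp: field_simps) (simp add: z_def)
    have "\<bar>g' x\<bar> * f (g x) = x powr (\<beta> - 1) / z ^ 2 * ((1 / z) powr (- (1 / \<beta>)) * (x powr \<beta> / z) powr (1 / \<beta> - 1))"
      using \<beta> x z unfolding g'_def f_def g_def z_def[symmetric] by (simp add: abs_mult)
    also have "\<dots> = x powr (\<beta> - 1) * x powr (1 - \<beta>) * (z powr (1 / \<beta>) * z powr (1 - 1 / \<beta>)) / z ^ 2"
    proof -
      have "(1 / z) powr (- (1 / \<beta>)) = z powr (1 / \<beta>)"
        using z by (simp add: powr_divide powr_minus field_simps)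
      moreover have "(x powr \<beta> / z) powr (1 / \<beta> - 1) = x powr (1 - \<beta>) * z powr (1 - 1 / \<beta>)"
      proof -
        have "(x powr \<beta> / z) powr (1 / \<beta> - 1) = x powr (\<beta> * (1 / \<beta> - 1)) / z powr (1 / \<beta> - 1)"
          using x z by (simp add: powr_divide powr_powr)
        also have "\<beta> * (1 / \<beta> - 1) = 1 - \<beta>"
          using \<beta> by (simp add: right_diff_distrib)
        finally show ?thesis
          using powr_minus_divide[of z "1 / \<beta> - 1"] by simp
      qed
      ultimately show ?thesis
        by simp
    qed
    also have "\<dots> = 1 / z"
      using \<beta> x z by (simp add: powr_add[symmetric] power2_eq_square)
    finally show ?thesis by (simp add: g_def z_def)
  qed
  have "(\<lambda>x. \<bar>g' x\<bar> * f (g x)) integrable_on {0<..}"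
    using * by (auto intro: set_lebesgue_integral_eq_integral)
  then have "((\<lambda>x. \<bar>g' x\<bar> * f (g x)) has_integral B) {0<..}"
    using * by (auto simp: has_integral_iff)
  then have "(g has_integral B) {0<..}"
    using eq by (subst has_integral_cong[OF eq[symmetric]]) auto
  from nn_integral_has_integral_lebesgue'[OF _ this] show ?thesis
    by (simp add: g_def B_def)
qed


lemma nn_integral_one_plus_powr_scaled:
  fixes \<beta> a :: real
  assumes \<beta>: "1 < \<beta>" and a: "0 < a"
  shows "(\<integral>\<^sup>+x. ennreal (1 / (1 + (a * x) powr \<beta>)) * indicator {0<..} x \<partial>lborel)
           = ennreal (pi / (\<beta> * sin (pi / \<beta>)) / a)"
proof -
  let ?f = "\<lambda>x. ennreal (1 / (1 + (a * x) powr \<beta>)) * indicator {0<..} x"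
  have "(\<integral>\<^sup>+x. ?f x \<partial>lborel) = ennreal (1 / a) * (\<integral>\<^sup>+x. ?f (x / a) \<partial>lborel)"
    using a nn_integral_real_affine[of ?f "1 / a" 0] by simp
  also have "(\<integral>\<^sup>+x. ?f (x / a) \<partial>lborel)
      = (\<integral>\<^sup>+x. ennreal (1 / (1 + x powr \<beta>)) * indicator {0<..} x \<partial>lborel)"
    using a by (intro nn_integral_cong) (auto split: split_indicator simp: zero_less_divide_iff)
  also have "\<dots> = ennreal (pi / (\<beta> * sin (pi / \<beta>)))"
    by (rule nn_integral_one_plus_powr[OF \<beta>])
  also have "ennreal (1 / a) * \<dots> = ennreal (pi / (\<beta> * sin (pi / \<beta>)) / a)"
    using a by (subst ennreal_mult'[symmetric]) (auto simp: mult_ac)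
  finally show ?thesis .
qed

section \<open>Scaling limit of the connection probability\<close>

text \<open>Since \<zeta> (r + r') = 4 ln N - \<zeta> (t + s), the factor of the squared sine is
  about N^4 exp (- \<zeta> (t + s)) / 2, while the squared sine is about x^2 / (4 N^2). The other
  term stays bounded and vanishes after division by N^2.\<close>

lemma tendsto_hyp_cosh_scaled:
  assumes \<zeta>: "0 < \<zeta>" and x: "0 < x"
  defines "R \<equiv> disc_radius \<zeta>"
  shows "(\<lambda>N. hyp_cosh \<zeta> (R N - t) (R N - s) (x / real N) / real N ^ 2)
           \<longlonglongrightarrow> exp (- (\<zeta> * (t + s))) * x\<^sup>2 / 8"
proof -
  define e where "e = exp (- (\<zeta> * (t + s)))"
  define d where "d = cosh (\<zeta> * (s - t))"
  have e: "e > 0" by (simp add: e_def)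
  \<comment> \<open>Of the factor N^4 taken out of the hyperbolic cosine, N^2 joins the squared sine
    and the rest cancels against the division.\<close>
  have "hyp_cosh \<zeta> (R N - t) (R N - s) (x / real N) / real N ^ 2
      = (e + 1 / (real N ^ 8 * e)) / 2 * (real N * sin (x / 2 / real N))\<^sup>2 + d * (cos (x / 2 / real N))\<^sup>2 / real N ^ 2"
    if "N > 0" for N
  proof -
    have "\<zeta> * (R N - t + (R N - s)) = 4 * ln (real N) - \<zeta> * (t + s)"
      using \<zeta> by (simp add: R_def disc_radius_def algebra_simps)
    moreover have "exp (4 * ln (real N)) = real N ^ 4"
      using that exp_of_nat_mult[of 4 "ln (real N)"] by simp
    then have "exp (4 * ln (real N) - \<zeta> * (t + s)) = real N ^ 4 * e"
      by (simp add: e_def exp_diff exp_minus divide_inverse)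
    ultimately have "cosh (\<zeta> * (R N - t + (R N - s))) = (real N ^ 4 * e + inverse (real N ^ 4 * e)) / 2"
      unfolding cosh_field_def exp_minus by simp
    also have "\<dots> = real N ^ 4 * ((e + 1 / (real N ^ 8 * e)) / 2)"
      using that e by (simp add: field_simps flip: power_add)
    finally show ?thesis
      using that by (simp add: hyp_cosh_eq d_def add_divide_distrib power_mult_distrib power2_eq_square power4_eq_xxxx mult_ac)
  qed
  moreover have "(\<lambda>N. (e + 1 / (real N ^ 8 * e)) / 2 * (real N * sin (x / 2 / real N))\<^sup>2
      + d * (cos (x / 2 / real N))\<^sup>2 / real N ^ 2) \<longlonglongrightarrow> (e + 0) / 2 * (x / 2)\<^sup>2 + 0"
  proof (intro tendsto_intros)
    show "(\<lambda>N. 1 / (real N ^ 8 * e)) \<longlonglongrightarrow> 0" using e by real_asymp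
    show "(\<lambda>N. real N * sin (x / 2 / real N)) \<longlonglongrightarrow> x / 2" by real_asymp
    show "(\<lambda>N. d * (cos (x / 2 / real N))\<^sup>2 / real N ^ 2) \<longlonglongrightarrow> 0" by real_asymp
  qed auto
  ultimately show ?thesis
    unfolding e_def[symmetric]
    by (subst tendsto_cong[OF eventually_mono[OF eventually_gt_at_top[of 0]]]) (auto simp: power_divide)
qed

text \<open>With h = c / N^2, where c is the value of \<open>hyp_cosh\<close>, one has exp (arcosh
  c) / N^2 = h + sqrt (h^2 - 1 / N^4). This tends to twice the limit of h, that is to (a x)^2, and
  the power \<beta> / 2 turns it into (a x)^\<beta>.\<close>

lemma tendsto_conn_prob_scaled:
  assumes \<zeta>: "0 < \<zeta>" and x: "0 < x"
  defines "R \<equiv> disc_radius \<zeta>"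
  shows "(\<lambda>N. conn_prob \<zeta> \<beta> (R N) (R N - t) (R N - s) (x / real N))
           \<longlonglongrightarrow> 1 / (1 + (exp (- (\<zeta> * (t + s) / 2)) / 2 * x) powr \<beta>)"
proof -
  define a where "a = exp (- (\<zeta> * (t + s) / 2)) / 2"
  define h where "h N = hyp_cosh \<zeta> (R N - t) (R N - s) (x / real N) / real N ^ 2" for N
  have a: "a > 0" "a ^ 2 = exp (- (\<zeta> * (t + s))) / 4"
    by (auto simp: a_def power2_eq_square exp_add[symmetric])
  have h: "h \<longlonglongrightarrow> (a * x)\<^sup>2 / 2"
    using tendsto_hyp_cosh_scaled[OF \<zeta> x, of t s] unfolding power_mult_distrib a
    by (simp add: h_def[abs_def] R_def)
  have "(\<lambda>N. h N + sqrt (h N ^ 2 - 1 / real N ^ 4)) \<longlonglongrightarrow> (a * x)\<^sup>2 / 2 + sqrt (((a * x)\<^sup>2 / 2)\<^sup>2 - 0)"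
    by (intro tendsto_intros h) real_asymp
  also have "(a * x)\<^sup>2 / 2 + sqrt (((a * x)\<^sup>2 / 2)\<^sup>2 - 0) = (a * x)\<^sup>2"
    by (simp add: real_sqrt_divide)
  finally have "(\<lambda>N. 1 / (1 + (h N + sqrt (h N ^ 2 - 1 / real N ^ 4)) powr (\<beta> / 2)))
      \<longlonglongrightarrow> 1 / (1 + ((a * x)\<^sup>2) powr (\<beta> / 2))"
    using a x by (intro tendsto_intros) (auto simp: add_nonneg_eq_0_iff)
  moreover have "((a * x)\<^sup>2) powr (\<beta> / 2) = (a * x) powr \<beta>"
    using a x by (simp add: powr_numeral[symmetric] powr_powr del: powr_numeral)
  moreover have "conn_prob \<zeta> \<beta> (R N) (R N - t) (R N - s) (x / real N)
      = 1 / (1 + (h N + sqrt (h N ^ 2 - 1 / real N ^ 4)) powr (\<beta> / 2))" if N: "N > 0" for N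
  proof -
    let ?c = "hyp_cosh \<zeta> (R N - t) (R N - s) (x / real N)"
    have "sqrt (?c\<^sup>2 - 1) / real N ^ 2 = sqrt ((?c\<^sup>2 - 1) / real N ^ 4)"
    proof -
      have "sqrt (real N ^ 4) = real N ^ 2"
        by (rule real_sqrt_unique) (auto simp flip: power_mult)
      then show ?thesis
        by (simp add: real_sqrt_divide)
    qed
    also have "(?c\<^sup>2 - 1) / real N ^ 4 = h N ^ 2 - 1 / real N ^ 4"
      by (simp add: h_def power_divide diff_divide_distrib)
    finally have "exp (arcosh ?c) / real N ^ 2 = h N + sqrt (h N ^ 2 - 1 / real N ^ 4)"
      by (simp add: exp_arcosh_real hyp_cosh_ge_1 h_def add_divide_distrib)
    then show ?thesis
      using conn_prob_powr[OF \<zeta> N] by (simp add: R_def)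
  qed
  ultimately show ?thesis
    unfolding a_def[symmetric]
    by (subst tendsto_cong[OF eventually_mono[OF eventually_gt_at_top[of 0]]]) auto
qed


section \<open>A majorant of the connection probability uniform in N\<close>

lemma sin_ge_linear:
  assumes "0 \<le> x" "x \<le> pi / 2"
  shows "2 / pi * x \<le> sin x"
proof -
  \<comment> \<open>Concavity of the sine places its graph above the chord from 0 to \<pi> /
    2.\<close>
  have "convex_on {0..pi} (\<lambda>x. - sin x)"
    by (rule f''_ge0_imp_convex[where f' = "\<lambda>x. - cos x" and f'' = sin])
       (auto intro!: derivative_eq_intros sin_ge_zero)
  from convex_onD[OF this, of "2 / pi * x" 0 "pi / 2"] show ?thesis
    using assms pi_gt_zero by (auto simp: field_simps)
qed

text \<open>The squared-cosine term is dropped, and the rest follows from cosh y \<ge> exp y / 2,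
  sin y \<ge> 2 y / \<pi> at the half angle, which the range of x keeps below \<pi> / 2, and exp
  (arcosh c) \<ge> c. The square of sqrt 2 \<pi> collects the losses 1 / 2 and 1 / \<pi>^2.\<close>

lemma conn_prob_scaled_le:
  assumes \<zeta>: "0 < \<zeta>" and \<beta>: "0 < \<beta>" and N: "0 < N" and x: "0 \<le> x" "x \<le> pi * real N"
  defines "R \<equiv> disc_radius \<zeta> N"
  shows "conn_prob \<zeta> \<beta> R (R - t) (R - s) (x / real N)
           \<le> 1 / (1 + (exp (- (\<zeta> * (t + s) / 2)) / (sqrt 2 * pi) * x) powr \<beta>)"
proof -
  define a where "a = exp (- (\<zeta> * (t + s) / 2)) / (sqrt 2 * pi)"
  have a: "a > 0" "a ^ 2 = exp (- (\<zeta> * (t + s))) / (2 * pi\<^sup>2)"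
    by (auto simp: a_def power_divide power_mult_distrib simp flip: exp_double)
  define c where "c = hyp_cosh \<zeta> (R - t) (R - s) (x / real N)"
  have N4: "exp (4 * ln (real N)) = real N ^ 4"
    using N exp_of_nat_mult[of 4 "ln (real N)"] by simp
  have "\<zeta> * (R - t + (R - s)) = 4 * ln (real N) + - (\<zeta> * (t + s))"
    using \<zeta> by (simp add: R_def disc_radius_def algebra_simps)
  then have "real N ^ 4 * exp (- (\<zeta> * (t + s))) / 2 = exp (\<zeta> * (R - t + (R - s))) / 2"
    by (simp only: exp_add N4)
  also have "\<dots> \<le> cosh (\<zeta> * (R - t + (R - s)))"
    by (simp add: cosh_field_def)
  finally have 1: "real N ^ 4 * exp (- (\<zeta> * (t + s))) / 2 \<le> cosh (\<zeta> * (R - t + (R - s)))" .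
  have "2 / pi * (x / real N / 2) \<le> sin (x / real N / 2)"
    using x N by (intro sin_ge_linear) (auto simp: field_simps)
  then have "(2 / pi * (x / real N / 2))\<^sup>2 \<le> (sin (x / real N / 2))\<^sup>2"
    using x by (intro power_mono) auto
  then have 2: "(x / (pi * real N))\<^sup>2 \<le> (sin (x / real N / 2))\<^sup>2"
    by simp
  have "real N ^ 2 * (a * x)\<^sup>2 = real N ^ 4 * exp (- (\<zeta> * (t + s))) / 2 * (x / (pi * real N))\<^sup>2"
    using N unfolding power_mult_distrib a by (simp add: field_simps power2_eq_square power4_eq_xxxx)
  also have "\<dots> \<le> cosh (\<zeta> * (R - t + (R - s))) * (sin (x / real N / 2))\<^sup>2"
    by (intro mult_mono 1 2) auto
  also have "\<dots> \<le> c"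
    by (simp add: c_def hyp_cosh_eq)
  also have "c \<le> exp (arcosh c)"
    using hyp_cosh_ge_1[of \<zeta> "R - t" "R - s" "x / real N"] by (simp add: exp_arcosh_real c_def)
  finally have "(a * x)\<^sup>2 \<le> exp (arcosh c) / real N ^ 2"
    using N by (simp add: field_simps)
  then have "((a * x)\<^sup>2) powr (\<beta> / 2) \<le> (exp (arcosh c) / real N ^ 2) powr (\<beta> / 2)"
    using \<beta> by (intro powr_mono2) auto
  moreover have "((a * x)\<^sup>2) powr (\<beta> / 2) = (a * x) powr \<beta>"
  \<comment> \<open>At \<open>x = 0\<close> both sides are 0, because \<open>0 powr b\<close> is
    0.\<close>
  proof (cases "x = 0")
    case False
    then have "a * x > 0" using a x by simp
    then show ?thesis by (simp add: powr_numeral[symmetric] powr_powr del: powr_numeral)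
  qed simp
  ultimately show ?thesis
    unfolding a_def[symmetric] R_def conn_prob_powr[OF \<zeta> N]
    by (intro divide_left_mono add_left_mono) (auto simp: c_def R_def add_pos_nonneg)
qed

text \<open>For positive N, this is N times the integral of the connection probability over the
  relative angle in [0, \<pi>], after the substitution \<phi> = x / N; t and s are the distances of
  the two points from the boundary circle.\<close>

definition angular_integral :: "real \<Rightarrow> real \<Rightarrow> nat \<Rightarrow> real \<Rightarrow> real \<Rightarrow> ennreal" where
  "angular_integral \<zeta> \<beta> N t s =
     (\<integral>\<^sup>+x. ennreal (conn_prob \<zeta> \<beta> (disc_radius \<zeta> N) (disc_radius \<zeta> N - t) (disc_radius \<zeta> N - s) (x / real N))
          * indicator {0..pi * real N} x \<partial>lborel)"

lemma measurable_angular_integral [measurable]: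
  "(\<lambda>s. angular_integral \<zeta> \<beta> N t s) \<in> borel_measurable borel"
  unfolding angular_integral_def by measurable

text \<open>The bound grows like exp (\<zeta> s / 2) in s, which is integrable against the decay exp
  (- \<alpha> s) of the radial density when \<zeta> < 2 \<alpha>.\<close>

lemma angular_integral_le:
  assumes \<zeta>: "0 < \<zeta>" and \<beta>: "1 < \<beta>" and N: "0 < N"
  shows "angular_integral \<zeta> \<beta> N t s
           \<le> ennreal (pi / (\<beta> * sin (pi / \<beta>)) * (sqrt 2 * pi) * exp (\<zeta> * (t + s) / 2))"
proof -
  define a where "a = exp (- (\<zeta> * (t + s) / 2)) / (sqrt 2 * pi)"
  have a: "a > 0" by (simp add: a_def)
  have "AE x in lborel. x \<noteq> (0::real)"
    by (rule AE_lborel_singleton)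
  then have "angular_integral \<zeta> \<beta> N t s
      \<le> (\<integral>\<^sup>+x. ennreal (1 / (1 + (a * x) powr \<beta>)) * indicator {0<..} x \<partial>lborel)"
    unfolding angular_integral_def a_def using conn_prob_scaled_le[OF \<zeta> _ N, of \<beta> _ t s] \<beta>
    by (intro nn_integral_mono_AE) (auto split: split_indicator intro!: ennreal_leI)
  also have "\<dots> = ennreal (pi / (\<beta> * sin (pi / \<beta>)) / a)"
    by (rule nn_integral_one_plus_powr_scaled[OF \<beta> a])
  finally show ?thesis
    by (simp add: a_def exp_minus field_simps)
qed

lemma tendsto_angular_integral:
  assumes \<zeta>: "0 < \<zeta>" and \<beta>: "1 < \<beta>"
  shows "(\<lambda>N. angular_integral \<zeta> \<beta> N t s)
           \<longlonglongrightarrow> ennreal (pi / (\<beta> * sin (pi / \<beta>)) * 2 * exp (\<zeta> * (t + s) / 2))"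
proof -
  define a where "a = exp (- (\<zeta> * (t + s) / 2)) / 2"
  define b where "b = exp (- (\<zeta> * (t + s) / 2)) / (sqrt 2 * pi)"
  have ab: "a > 0" "b > 0" by (simp_all add: a_def b_def)
  have nz: "AE x in lborel. x \<noteq> (0::real)"
    by (rule AE_lborel_singleton)
  \<comment> \<open>The shift by \<open>Suc\<close> is made because the majorant is available for
    positive \<open>N\<close>.\<close>
  have "(\<lambda>N. angular_integral \<zeta> \<beta> (Suc N) t s)
      \<longlonglongrightarrow> (\<integral>\<^sup>+x. ennreal (1 / (1 + (a * x) powr \<beta>)) * indicator {0<..} x \<partial>lborel)"
    unfolding angular_integral_def
  proof (rule nn_integral_dominated_convergence[where w = "\<lambda>x. ennreal (1 / (1 + (b * x) powr \<beta>)) * indicator {0<..} x"])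
    fix N
    show "AE x in lborel. ennreal (conn_prob \<zeta> \<beta> (disc_radius \<zeta> (Suc N)) (disc_radius \<zeta> (Suc N) - t)
              (disc_radius \<zeta> (Suc N) - s) (x / real (Suc N))) * indicator {0..pi * real (Suc N)} x
          \<le> ennreal (1 / (1 + (b * x) powr \<beta>)) * indicator {0<..} x"
      using nz unfolding b_def
    proof eventually_elim
      case (elim x)
      then show ?case
        using conn_prob_scaled_le[OF \<zeta>, of \<beta> "Suc N" x t s] \<beta>
        by (auto split: split_indicator intro!: ennreal_leI)
    qed
  next
    show "(\<integral>\<^sup>+x. ennreal (1 / (1 + (b * x) powr \<beta>)) * indicator {0<..} x \<partial>lborel) < \<infinity>"
      by (simp add: nn_integral_one_plus_powr_scaled[OF \<beta> ab(2)])
  next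
    show "AE x in lborel. (\<lambda>N. ennreal (conn_prob \<zeta> \<beta> (disc_radius \<zeta> (Suc N)) (disc_radius \<zeta> (Suc N) - t)
              (disc_radius \<zeta> (Suc N) - s) (x / real (Suc N))) * indicator {0..pi * real (Suc N)} x)
          \<longlonglongrightarrow> ennreal (1 / (1 + (a * x) powr \<beta>)) * indicator {0<..} x"
      using nz
    proof eventually_elim
      case (elim x)
      show ?case
      proof (cases "0 < x")
        case True
        have "(\<lambda>N. ennreal (conn_prob \<zeta> \<beta> (disc_radius \<zeta> (Suc N)) (disc_radius \<zeta> (Suc N) - t)
              (disc_radius \<zeta> (Suc N) - s) (x / real (Suc N)))) \<longlonglongrightarrow> ennreal (1 / (1 + (a * x) powr \<beta>))"
          using tendsto_conn_prob_scaled[OF \<zeta> True, of \<beta> t s, THEN LIMSEQ_Suc]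
          unfolding a_def by (rule tendsto_ennrealI)
        \<comment> \<open>The growing interval eventually contains the fixed point \<open>x\<close>,
          so the indicator becomes 1.\<close>
        moreover have "\<forall>\<^sub>F N in sequentially. x \<le> pi * real (Suc N)"
          by real_asymp
        then have "\<forall>\<^sub>F N in sequentially. ennreal (conn_prob \<zeta> \<beta> (disc_radius \<zeta> (Suc N))
              (disc_radius \<zeta> (Suc N) - t) (disc_radius \<zeta> (Suc N) - s) (x / real (Suc N)))
            = ennreal (conn_prob \<zeta> \<beta> (disc_radius \<zeta> (Suc N)) (disc_radius \<zeta> (Suc N) - t)
              (disc_radius \<zeta> (Suc N) - s) (x / real (Suc N))) * indicator {0..pi * real (Suc N)} x"
          by eventually_elim (use True in auto)
        ultimately show ?thesis
          using True by (auto intro: Lim_transform_eventually)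
      next
        case False
        then show ?thesis using elim by simp
      qed
    qed
  qed measurable
  then have "(\<lambda>N. angular_integral \<zeta> \<beta> N t s)
      \<longlonglongrightarrow> (\<integral>\<^sup>+x. ennreal (1 / (1 + (a * x) powr \<beta>)) * indicator {0<..} x \<partial>lborel)"
    by (rule LIMSEQ_imp_Suc)
  moreover have "pi / (\<beta> * sin (pi / \<beta>)) / a = pi / (\<beta> * sin (pi / \<beta>)) * 2 * exp (\<zeta> * (t + s) / 2)"
    by (simp add: a_def exp_minus field_simps)
  ultimately show ?thesis
    by (simp add: nn_integral_one_plus_powr_scaled[OF \<beta> ab(1)])
qed

section \<open>Expected degree of a vertex at given radius\<close>

text \<open>The indicator is part of the density: in the depth coordinate t = R - r it vanishes
  outside 0 \<le> t \<le> R, so integrals may run over the whole line.\<close>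

definition radial_density :: "real \<Rightarrow> real \<Rightarrow> real \<Rightarrow> real" where
  "radial_density \<alpha> R r = indicator {0..R} r * (\<alpha> * sinh (\<alpha> * r) / (cosh (\<alpha> * R) - 1))"

lemma measurable_radial_density [measurable]: "radial_density \<alpha> R \<in> borel_measurable borel"
proof -
  have [measurable]: "(sinh :: real \<Rightarrow> real) \<in> borel_measurable borel"
    by (intro borel_measurable_continuous_onI continuous_intros)
  show ?thesis
    unfolding radial_density_def[abs_def] by measurable
qed

lemma cosh_minus_one: "cosh x - 1 = exp x * (1 - exp (- x))\<^sup>2 / (2::real)"
  by (simp add: cosh_field_def exp_minus field_simps power2_eq_square)

text \<open>The hypothesis makes (1 - exp (- \<alpha> R))^2 at least 1 / 4, so the denominator is at
  least exp (\<alpha> R) / 8. Together with sinh y \<le> exp y / 2 this gives the constant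
  4.\<close>

lemma radial_density_le:
  assumes \<alpha>: "0 < \<alpha>" and R: "exp (- (\<alpha> * R)) \<le> 1 / 2"
  shows "radial_density \<alpha> R (R - t) \<le> 4 * \<alpha> * exp (- (\<alpha> * t)) * indicator {0..} t"
proof (cases "t \<in> {0..R}")
  case True
  have "(1 / 2)\<^sup>2 \<le> (1 - exp (- (\<alpha> * R)))\<^sup>2"
    using R by (intro power_mono) auto
  then have "exp (\<alpha> * R) * (1 / 2)\<^sup>2 / 2 \<le> cosh (\<alpha> * R) - 1"
    unfolding cosh_minus_one by (intro divide_right_mono mult_left_mono) auto
  then have c: "exp (\<alpha> * R) / 8 \<le> cosh (\<alpha> * R) - 1"
    by (simp add: power2_eq_square)
  have "sinh (\<alpha> * (R - t)) \<le> exp (\<alpha> * (R - t)) / 2"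
    by (simp add: sinh_field_def)
  then have "\<alpha> * sinh (\<alpha> * (R - t)) / (cosh (\<alpha> * R) - 1) \<le> \<alpha> * (exp (\<alpha> * (R - t)) / 2) / (exp (\<alpha> * R) / 8)"
    using \<alpha> by (intro frac_le c mult_left_mono) auto
  also have "\<dots> = 4 * \<alpha> * exp (- (\<alpha> * t))"
    by (simp add: right_diff_distrib exp_diff exp_minus field_simps)
  finally show ?thesis
    using True by (simp add: radial_density_def)
next
  case False
  then show ?thesis
    using \<alpha> by (auto simp: radial_density_def indicator_def)
qed

lemma filterlim_disc_radius:
  assumes "0 < \<zeta>"
  shows "filterlim (disc_radius \<zeta>) at_top sequentially"
  unfolding disc_radius_def[abs_def] using assms by real_asymp

lemma eventually_exp_disc_radius_small:
  assumes \<zeta>: "0 < \<zeta>" and \<alpha>: "0 < \<alpha>"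
  shows "\<forall>\<^sub>F N in sequentially. exp (- (\<alpha> * disc_radius \<zeta> N)) \<le> 1 / 2 \<and> 2 \<le> N"
proof -
  have "filterlim (\<lambda>N. \<alpha> * disc_radius \<zeta> N) at_top sequentially"
    by (rule filterlim_tendsto_pos_mult_at_top[OF tendsto_const \<alpha> filterlim_disc_radius[OF \<zeta>]])
  then have "(\<lambda>N. exp (- (\<alpha> * disc_radius \<zeta> N))) \<longlonglongrightarrow> 0"
    by (intro filterlim_compose[OF exp_at_bot]) (simp add: filterlim_uminus_at_top)
  then have "\<forall>\<^sub>F N in sequentially. exp (- (\<alpha> * disc_radius \<zeta> N)) < 1 / 2"
    by (rule order_tendstoD) simp
  then show ?thesis
    using eventually_ge_at_top[of 2] by eventually_elim auto
qed

text \<open>In probabilistic terms, the depth of a random point below the boundary is asymptotically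
  exponential with rate \<alpha>.\<close>

lemma tendsto_radial_density:
  assumes \<alpha>: "0 < \<alpha>" and R: "filterlim R at_top sequentially"
  shows "(\<lambda>N. radial_density \<alpha> (R N) (R N - t)) \<longlonglongrightarrow> \<alpha> * exp (- (\<alpha> * t)) * indicator {0..} t"
proof (cases "0 \<le> t")
  case True
  have "((\<lambda>r. \<alpha> * sinh (\<alpha> * (r - t)) / (cosh (\<alpha> * r) - 1)) \<longlongrightarrow> \<alpha> * exp (- (\<alpha> * t))) at_top"
  proof -
    \<comment> \<open>This is the quotient with the common factor
      \<open>exp (\<alpha> * r) / 2\<close> cancelled.\<close>
    have "((\<lambda>r. \<alpha> * (exp (- (\<alpha> * t)) - exp (\<alpha> * t) * exp (- (2 * \<alpha> * r))) / (1 - exp (- (\<alpha> * r)))\<^sup>2) \<longlongrightarrow> \<alpha> * exp (- (\<alpha> * t))) at_top"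
      using \<alpha> by real_asymp
    moreover have "\<alpha> * (exp (- (\<alpha> * t)) - exp (\<alpha> * t) * exp (- (2 * \<alpha> * r))) / (1 - exp (- (\<alpha> * r)))\<^sup>2
        = \<alpha> * sinh (\<alpha> * (r - t)) / (cosh (\<alpha> * r) - 1)" for r
    proof -
      have "sinh (\<alpha> * (r - t)) = exp (\<alpha> * r) * (exp (- (\<alpha> * t)) - exp (\<alpha> * t) * exp (- (2 * \<alpha> * r))) / 2"
        by (simp add: sinh_field_def algebra_simps flip: exp_add)
      moreover have "\<alpha> * b / c = \<alpha> * (exp (\<alpha> * r) * b / 2) / (exp (\<alpha> * r) * c / 2)" for b c
        by simp
      ultimately show ?thesis
        unfolding cosh_minus_one by metis
    qed
    ultimately show ?thesis by simp
  qed
  from filterlim_compose[OF this R]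
  have "(\<lambda>N. \<alpha> * sinh (\<alpha> * (R N - t)) / (cosh (\<alpha> * R N) - 1)) \<longlonglongrightarrow> \<alpha> * exp (- (\<alpha> * t))" .
  moreover have "\<forall>\<^sub>F N in sequentially. t \<le> R N"
    using R by (simp add: filterlim_at_top)
  then have "\<forall>\<^sub>F N in sequentially. \<alpha> * sinh (\<alpha> * (R N - t)) / (cosh (\<alpha> * R N) - 1)
      = radial_density \<alpha> (R N) (R N - t)"
    by eventually_elim (use True in \<open>simp add: radial_density_def\<close>)
  ultimately show ?thesis
    using True by (auto intro: Lim_transform_eventually)
next
  case False
  then show ?thesis by (simp add: radial_density_def)
qed

section \<open>Averaging over the position of the other endpoint\<close>

lemma nn_integral_point_law:
  fixes f :: "real \<times> real \<Rightarrow> ennreal"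
  assumes \<alpha>: "0 < \<alpha>" and [measurable]: "f \<in> borel_measurable (borel \<Otimes>\<^sub>M borel)"
  shows "(\<integral>\<^sup>+y. f y \<partial>point_law \<alpha> R) = (\<integral>\<^sup>+r. ennreal (radial_density \<alpha> R r) *
           (ennreal (1 / (2 * pi)) * (\<integral>\<^sup>+\<theta>. f (r, \<theta>) * indicator {0<..2 * pi} \<theta> \<partial>lborel)) \<partial>lborel)"
proof -
  let ?A = "density lborel (\<lambda>r. ennreal (radial_density \<alpha> R r))"
  let ?U = "uniform_measure lborel {0<..2 * pi}"
  interpret U: prob_space ?U
    by (rule prob_space_uniform_measure) auto
  have "(\<integral>\<^sup>+y. f y \<partial>point_law \<alpha> R) = (\<integral>\<^sup>+r. \<integral>\<^sup>+\<theta>. f (r, \<theta>) \<partial>?U \<partial>?A)"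
    unfolding point_law_def radial_density_def[symmetric]
    by (subst U.nn_integral_fst[symmetric]) auto
  also have "\<dots> = (\<integral>\<^sup>+r. ennreal (radial_density \<alpha> R r) * (\<integral>\<^sup>+\<theta>. f (r, \<theta>) \<partial>?U) \<partial>lborel)"
    by (subst nn_integral_density) auto
  also have "\<dots> = (\<integral>\<^sup>+r. ennreal (radial_density \<alpha> R r) *
           (ennreal (1 / (2 * pi)) * (\<integral>\<^sup>+\<theta>. f (r, \<theta>) * indicator {0<..2 * pi} \<theta> \<partial>lborel)) \<partial>lborel)"
    by (intro nn_integral_cong arg_cong2[where f = times] refl, subst nn_integral_uniform_measure)
       (auto simp: divide_ennreal_def inverse_ennreal mult.commute inverse_eq_divide)
  finally show ?thesis .
qed

text \<open>The success probability of the binomial law of the degree, given that the vertex sits at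
  \<open>y\<close>.\<close>

definition link_prob :: "real \<Rightarrow> real \<Rightarrow> real \<Rightarrow> nat \<Rightarrow> real \<times> real \<Rightarrow> real" where
  "link_prob \<zeta> \<alpha> \<beta> N y
     = (\<integral>z. edge_prob \<zeta> \<beta> (disc_radius \<zeta> N) y z \<partial>point_law \<alpha> (disc_radius \<zeta> N))"

text \<open>The two half circles turn 1 / (2 \<pi>) into 1 / \<pi>, and the factor N compensates the
  Jacobian of \<phi> = x / N. The right-hand side is free of \<theta>, which later yields rotation
  invariance.\<close>

lemma link_prob_scaled:
  assumes \<zeta>: "0 < \<zeta>" and \<alpha>: "0 < \<alpha>" and N: "2 \<le> N" and \<theta>: "0 \<le> \<theta>" "\<theta> \<le> 2 * pi"
  defines "R \<equiv> disc_radius \<zeta> N"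
  shows "ennreal (real N * link_prob \<zeta> \<alpha> \<beta> N (R - t, \<theta>))
           = ennreal (1 / pi) * (\<integral>\<^sup>+s. ennreal (radial_density \<alpha> R (R - s)) * angular_integral \<zeta> \<beta> N t s \<partial>lborel)"
proof -
  have "0 < R"
    using \<zeta> N by (simp add: R_def disc_radius_def)
  then interpret M: prob_space "point_law \<alpha> R"
    by (intro prob_space_point_law \<alpha>)
  have m[measurable]: "edge_prob \<zeta> \<beta> R y \<in> borel_measurable (borel \<Otimes>\<^sub>M borel)" for y
    by (rule measurable_edge_prob[where f = "\<lambda>_. y" and g = "\<lambda>z. z"]) (auto simp: space_pair_measure)
  have int: "integrable (point_law \<alpha> R) (edge_prob \<zeta> \<beta> R y)" for y
    using edge_prob_bounds[of \<zeta> \<beta> R y, THEN less_imp_le]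
    by (intro M.integrable_const_bound[where B = 1]) auto
  have "ennreal (link_prob \<zeta> \<alpha> \<beta> N (R - t, \<theta>))
      = (\<integral>\<^sup>+z. ennreal (edge_prob \<zeta> \<beta> R (R - t, \<theta>) z) \<partial>point_law \<alpha> R)"
    unfolding link_prob_def R_def[symmetric]
    using edge_prob_bounds[of \<zeta> \<beta> R, THEN less_imp_le]
    by (intro nn_integral_eq_integral[symmetric] int) auto
  also have "\<dots> = (\<integral>\<^sup>+r. ennreal (radial_density \<alpha> R r) * (ennreal (1 / (2 * pi)) *
      (\<integral>\<^sup>+\<theta>'. ennreal (conn_prob \<zeta> \<beta> R (R - t) r (\<theta> - \<theta>')) * indicator {0<..2 * pi} \<theta>' \<partial>lborel)) \<partial>lborel)"
    by (subst nn_integral_point_law[OF \<alpha>]) (auto simp: edge_prob_eq_conn_prob)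
  also have "\<dots> = (\<integral>\<^sup>+s. ennreal (radial_density \<alpha> R (R - s)) * (ennreal (1 / (2 * pi)) *
      (\<integral>\<^sup>+\<theta>'. ennreal (conn_prob \<zeta> \<beta> R (R - t) (R - s) (\<theta> - \<theta>')) * indicator {0<..2 * pi} \<theta>' \<partial>lborel)) \<partial>lborel)"
    by (rule nn_integral_lborel_reflect[symmetric]) measurable
  also have "\<dots> = (\<integral>\<^sup>+s. ennreal (1 / (pi * real N)) * (ennreal (radial_density \<alpha> R (R - s)) * angular_integral \<zeta> \<beta> N t s) \<partial>lborel)"
  proof (rule nn_integral_cong)
    fix s
    let ?f = "\<lambda>x. ennreal (conn_prob \<zeta> \<beta> R (R - t) (R - s) x)"
    have "(\<integral>\<^sup>+\<theta>'. ?f (\<theta> - \<theta>') * indicator {0<..2 * pi} \<theta>' \<partial>lborel) = 2 * (\<integral>\<^sup>+x. ?f x * indicator {0..pi} x \<partial>lborel)"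
      by (rule nn_integral_even_periodic) (use \<theta> in \<open>auto simp: conn_prob_minus conn_prob_periodic\<close>)
    also have "(\<integral>\<^sup>+x. ?f x * indicator {0..pi} x \<partial>lborel) = ennreal (1 / real N) * angular_integral \<zeta> \<beta> N t s"
      using N nn_integral_real_affine[of "\<lambda>x. ?f x * indicator {0..pi} x" "1 / real N" 0]
      by (auto simp: angular_integral_def R_def field_simps split: split_indicator
           intro!: arg_cong2[where f = times] nn_integral_cong)
    also have "ennreal (1 / (2 * pi)) * (2 * (ennreal (1 / real N) * angular_integral \<zeta> \<beta> N t s))
        = (ennreal (1 / (2 * pi)) * ennreal 2 * ennreal (1 / real N)) * angular_integral \<zeta> \<beta> N t s"
      by (simp add: mult.assoc)
    also have "ennreal (1 / (2 * pi)) * ennreal 2 * ennreal (1 / real N) = ennreal (1 / (pi * real N))"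
      by (subst ennreal_mult'[symmetric], simp, subst ennreal_mult'[symmetric], auto)
    finally show "ennreal (radial_density \<alpha> R (R - s)) * (ennreal (1 / (2 * pi)) *
        (\<integral>\<^sup>+\<theta>'. ?f (\<theta> - \<theta>') * indicator {0<..2 * pi} \<theta>' \<partial>lborel))
      = ennreal (1 / (pi * real N)) * (ennreal (radial_density \<alpha> R (R - s)) * angular_integral \<zeta> \<beta> N t s)"
      by (simp add: mult_ac)
  qed
  also have "\<dots> = ennreal (1 / (pi * real N)) * (\<integral>\<^sup>+s. ennreal (radial_density \<alpha> R (R - s)) * angular_integral \<zeta> \<beta> N t s \<partial>lborel)"
    by (rule nn_integral_cmult) measurable
  finally have "ennreal (real N) * ennreal (link_prob \<zeta> \<alpha> \<beta> N (R - t, \<theta>)) = (ennreal (real N) * ennreal (1 / (pi * real N))) *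
      (\<integral>\<^sup>+s. ennreal (radial_density \<alpha> R (R - s)) * angular_integral \<zeta> \<beta> N t s \<partial>lborel)"
    by (simp only: mult.assoc)
  moreover have "ennreal (real N) * ennreal (1 / (pi * real N)) = ennreal (1 / pi)"
    using N by (subst ennreal_mult'[symmetric]) auto
  ultimately show ?thesis
    by (simp add: ennreal_mult')
qed

lemma nn_integral_exp_neg_Ici:
  assumes c: "0 < c"
  shows "(\<integral>\<^sup>+s. ennreal (exp (- (c * s))) * indicator {0..} s \<partial>lborel) = ennreal (1 / c)"
proof -
  interpret prob_space "density lborel (exponential_density c)"
    by (rule prob_space_exponential_density[OF c])
  have "1 = (\<integral>\<^sup>+s. ennreal (exponential_density c s) \<partial>lborel)"
    using emeasure_space_1 by (simp add: emeasure_density)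
  also have "\<dots> = (\<integral>\<^sup>+s. ennreal c * (ennreal (exp (- (c * s))) * indicator {0..} s) \<partial>lborel)"
    using c by (intro nn_integral_cong)
      (auto simp: exponential_density_def ennreal_mult' mult_ac split: split_indicator)
  also have "\<dots> = ennreal c * (\<integral>\<^sup>+s. ennreal (exp (- (c * s))) * indicator {0..} s \<partial>lborel)"
    by (rule nn_integral_cmult) measurable
  finally have "ennreal (1 / c) * 1 = ennreal (1 / c) * ennreal c * (\<integral>\<^sup>+s. ennreal (exp (- (c * s))) * indicator {0..} s \<partial>lborel)"
    by (simp only: mult.assoc)
  moreover have "ennreal (1 / c) * ennreal c = 1"
    using c by (subst ennreal_mult'[symmetric]) auto
  ultimately show ?thesis by simp
qed

text \<open>Dominated convergence in s leaves (2 I / \<pi>) exp (\<zeta> t / 2) times the integral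
  of \<alpha> exp (- (\<alpha> - \<zeta> / 2) s) over s \<ge> 0, where I is the integral of 1 / (1 +
  x^\<beta>). The last integral is 2 \<alpha> / (2 \<alpha> - \<zeta>), finite by
  \<open>ratio\<close>, and the constants multiply to \<open>K\<close>.\<close>

lemma tendsto_link_prob:
  assumes \<zeta>: "0 < \<zeta>" and \<alpha>: "0 < \<alpha>" and \<beta>: "1 < \<beta>" and ratio: "\<zeta> < 2 * \<alpha>"
    and \<theta>: "0 \<le> \<theta>" "\<theta> \<le> 2 * pi"
  defines "K \<equiv> 4 * \<alpha> / (2 * \<alpha> - \<zeta>) * (1 / \<beta>) * (1 / sin (pi / \<beta>))"
  shows "(\<lambda>N. real N * link_prob \<zeta> \<alpha> \<beta> N (disc_radius \<zeta> N - t, \<theta>)) \<longlonglongrightarrow> K * exp (\<zeta> * t / 2)"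
proof -
  define R where "R = disc_radius \<zeta>"
  define I where "I = pi / (\<beta> * sin (pi / \<beta>))"
  have "0 < sin (pi / \<beta>)"
    using \<beta> by (intro sin_gt_zero) (auto simp: field_simps)
  then have I: "0 < I"
    using \<beta> by (simp add: I_def)
  have lim_R: "filterlim R at_top sequentially"
    unfolding R_def by (rule filterlim_disc_radius[OF \<zeta>])
  \<comment> \<open>The radial majorant holds from \<open>n\<close> on; the sequence is shifted by
    \<open>n\<close> so that domination holds at every index.\<close>
  from eventually_exp_disc_radius_small[OF \<zeta> \<alpha>]
  obtain n where n: "\<And>N. n \<le> N \<Longrightarrow> exp (- (\<alpha> * R N)) \<le> 1 / 2" "\<And>N. n \<le> N \<Longrightarrow> 2 \<le> N"
    unfolding eventually_sequentially R_def by blast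
  define L where "L N = (\<integral>\<^sup>+s. ennreal (radial_density \<alpha> (R N) (R N - s)) * angular_integral \<zeta> \<beta> N t s \<partial>lborel)" for N
  have split: "exp (\<zeta> * (t + s) / 2) = exp (\<zeta> * t / 2) * exp (\<zeta> * s / 2)" for s
    by (simp add: distrib_left add_divide_distrib exp_add)
  \<comment> \<open>The limit and the majorant differ only in the constants \<open>c\<close> and
    \<open>d\<close>, so one evaluation serves both.\<close>
  have comb: "(\<integral>\<^sup>+s. ennreal (c * exp (- (\<alpha> * s)) * indicator {0..} s) * ennreal (d * exp (\<zeta> * (t + s) / 2)) \<partial>lborel)
      = ennreal (c * d * exp (\<zeta> * t / 2) * (2 / (2 * \<alpha> - \<zeta>)))" if "0 \<le> c" "0 \<le> d" for c d
  proof -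
    have "(\<integral>\<^sup>+s. ennreal (c * exp (- (\<alpha> * s)) * indicator {0..} s) * ennreal (d * exp (\<zeta> * (t + s) / 2)) \<partial>lborel)
        = (\<integral>\<^sup>+s. ennreal (c * d * exp (\<zeta> * t / 2)) * (ennreal (exp (- ((\<alpha> - \<zeta> / 2) * s))) * indicator {0..} s) \<partial>lborel)"
    proof (rule nn_integral_cong)
      fix s
      have "exp (- ((\<alpha> - \<zeta> / 2) * s)) = exp (- (\<alpha> * s)) * exp (\<zeta> * s / 2)"
        by (simp add: left_diff_distrib flip: exp_add)
      then show "ennreal (c * exp (- (\<alpha> * s)) * indicator {0..} s) * ennreal (d * exp (\<zeta> * (t + s) / 2))
          = ennreal (c * d * exp (\<zeta> * t / 2)) * (ennreal (exp (- ((\<alpha> - \<zeta> / 2) * s))) * indicator {0..} s)"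
        using that by (auto simp: split mult_ac split: split_indicator simp flip: ennreal_mult)
    qed
    also have "\<dots> = ennreal (c * d * exp (\<zeta> * t / 2)) * ennreal (1 / (\<alpha> - \<zeta> / 2))"
      using ratio by (subst nn_integral_cmult) (auto simp: nn_integral_exp_neg_Ici)
    also have "\<dots> = ennreal (c * d * exp (\<zeta> * t / 2) * (2 / (2 * \<alpha> - \<zeta>)))"
      using that ratio by (subst ennreal_mult[symmetric]) (auto simp: field_simps)
    finally show ?thesis .
  qed
  have "(\<lambda>N. L (N + n)) \<longlonglongrightarrow>
      (\<integral>\<^sup>+s. ennreal (\<alpha> * exp (- (\<alpha> * s)) * indicator {0..} s) * ennreal (I * 2 * exp (\<zeta> * (t + s) / 2)) \<partial>lborel)"
    unfolding L_def
  proof (rule nn_integral_dominated_convergence[where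
        w = "\<lambda>s. ennreal (4 * \<alpha> * exp (- (\<alpha> * s)) * indicator {0..} s) * ennreal (I * (sqrt 2 * pi) * exp (\<zeta> * (t + s) / 2))"])
    show "AE s in lborel. ennreal (radial_density \<alpha> (R (N + n)) (R (N + n) - s)) * angular_integral \<zeta> \<beta> (N + n) t s
        \<le> ennreal (4 * \<alpha> * exp (- (\<alpha> * s)) * indicator {0..} s) * ennreal (I * (sqrt 2 * pi) * exp (\<zeta> * (t + s) / 2))" for N
      using n[of "N + n"] unfolding I_def
      by (intro AE_I2 mult_mono ennreal_leI radial_density_le angular_integral_le \<alpha> \<beta> \<zeta>) auto
    show "(\<integral>\<^sup>+s. ennreal (4 * \<alpha> * exp (- (\<alpha> * s)) * indicator {0..} s) * ennreal (I * (sqrt 2 * pi) * exp (\<zeta> * (t + s) / 2)) \<partial>lborel) < \<infinity>"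
      using \<alpha> I by (subst comb) auto
    show "AE s in lborel. (\<lambda>N. ennreal (radial_density \<alpha> (R (N + n)) (R (N + n) - s)) * angular_integral \<zeta> \<beta> (N + n) t s)
        \<longlonglongrightarrow> ennreal (\<alpha> * exp (- (\<alpha> * s)) * indicator {0..} s) * ennreal (I * 2 * exp (\<zeta> * (t + s) / 2))"
      unfolding I_def
      by (intro AE_I2 tendsto_mult_ennreal tendsto_ennrealI LIMSEQ_ignore_initial_segment
          tendsto_radial_density[OF \<alpha> lim_R] tendsto_angular_integral[OF \<zeta> \<beta>]) auto
  qed measurable
  then have "L \<longlonglongrightarrow> ennreal (\<alpha> * (I * 2) * exp (\<zeta> * t / 2) * (2 / (2 * \<alpha> - \<zeta>)))"
    using \<alpha> I by (subst (asm) comb) (auto intro: LIMSEQ_offset)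
  then have "(\<lambda>N. ennreal (1 / pi) * L N) \<longlonglongrightarrow> ennreal (1 / pi) * ennreal (\<alpha> * (I * 2) * exp (\<zeta> * t / 2) * (2 / (2 * \<alpha> - \<zeta>)))"
    by (intro tendsto_mult_ennreal tendsto_const) auto
  also have "ennreal (1 / pi) * ennreal (\<alpha> * (I * 2) * exp (\<zeta> * t / 2) * (2 / (2 * \<alpha> - \<zeta>))) = ennreal (K * exp (\<zeta> * t / 2))"
    by (subst ennreal_mult'[symmetric]) (auto simp: I_def K_def mult_ac)
  finally have "(\<lambda>N. ennreal (real N * link_prob \<zeta> \<alpha> \<beta> N (R N - t, \<theta>))) \<longlonglongrightarrow> ennreal (K * exp (\<zeta> * t / 2))"
    by (rule Lim_transform_eventually)
       (auto intro!: eventually_mono[OF eventually_ge_at_top[of 2]] simp: L_def R_def link_prob_scaled[OF \<zeta> \<alpha> _ \<theta>])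
  moreover have "0 \<le> link_prob \<zeta> \<alpha> \<beta> N y" for N y
    unfolding link_prob_def using edge_prob_bounds[THEN less_imp_le] by (intro integral_nonneg_AE) auto
  moreover have "0 \<le> K"
    using \<open>0 < sin (pi / \<beta>)\<close> \<alpha> \<beta> ratio by (simp add: K_def)
  ultimately show ?thesis
    by (subst (asm) tendsto_ennreal_iff) (auto simp: R_def)
qed

section \<open>Poisson limit of the degree\<close>

lemma tendsto_binomial_pred_scaled:
  "(\<lambda>N. real ((N - 1) choose k) / real N ^ k) \<longlonglongrightarrow> 1 / fact k"
proof -
  have "(\<lambda>N. (\<Prod>i=0..<k. (real N - 1 - real i) / real N) / fact k) \<longlonglongrightarrow> (\<Prod>i=0..<k. 1) / fact k"
    by (intro tendsto_intros tendsto_prod) (real_asymp | simp)+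
  then have lim: "(\<lambda>N. (\<Prod>i=0..<k. (real N - 1 - real i) / real N) / fact k) \<longlonglongrightarrow> 1 / fact k"
    by simp
  have eq: "(\<Prod>i=0..<k. (real N - 1 - real i) / real N) / fact k = real ((N - 1) choose k) / real N ^ k"
    if "N > 0" for N
    using that by (simp add: binomial_gbinomial gbinomial_prod_rev prod_dividef of_nat_diff)
  show ?thesis
    by (rule Lim_transform_eventually[OF lim eventually_mono[OF eventually_gt_at_top[of 0] eq]])
qed

text \<open>For 0 \<le> q < 1 / 2 the logarithm of 1 - q lies between - q - 2 q^2 and - q.
  Multiplied by N, both bounds tend to - l, because q itself tends to 0.\<close>

lemma tendsto_one_minus_power:
  fixes q :: "nat \<Rightarrow> real"
  assumes q: "\<And>N. 0 \<le> q N" and lim: "(\<lambda>N. real N * q N) \<longlonglongrightarrow> l"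
  shows "(\<lambda>N. (1 - q N) ^ N) \<longlonglongrightarrow> exp (- l)" and "q \<longlonglongrightarrow> 0"
proof -
  have "(\<lambda>N. real N * q N * (1 / real N)) \<longlonglongrightarrow> l * 0"
    by (intro tendsto_mult lim) real_asymp
  then have "(\<lambda>N. real N * q N * (1 / real N)) \<longlonglongrightarrow> 0" by simp
  then show q0: "q \<longlonglongrightarrow> 0"
    by (rule Lim_transform_eventually[OF _ eventually_mono[OF eventually_gt_at_top[of 0]]]) simp
  then have small: "\<forall>\<^sub>F N in sequentially. q N < 1 / 2"
    by (rule order_tendstoD) simp
  have "(\<lambda>N. real N * ln (1 - q N)) \<longlonglongrightarrow> - l"
  proof (rule tendsto_sandwich)
    show "\<forall>\<^sub>F N in sequentially. - (real N * q N) - 2 * (real N * q N) * q N \<le> real N * ln (1 - q N)"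
      using small
    proof eventually_elim
      case (elim N)
      have "real N * (- q N - 2 * (q N)\<^sup>2) \<le> real N * ln (1 - q N)"
        using elim q[of N] by (intro mult_left_mono ln_one_minus_pos_lower_bound) auto
      then show ?case by (simp add: algebra_simps power2_eq_square)
    qed
    show "\<forall>\<^sub>F N in sequentially. real N * ln (1 - q N) \<le> - (real N * q N)"
      using small
    proof eventually_elim
      case (elim N)
      have "ln (1 - q N) \<le> - q N"
        using elim ln_add_one_self_le_self2[of "- q N"] by simp
      then have "real N * ln (1 - q N) \<le> real N * - q N"
        by (intro mult_left_mono) auto
      then show ?case by simp
    qed
    have "(\<lambda>N. - (real N * q N) - 2 * (real N * q N) * q N) \<longlonglongrightarrow> - l - 2 * l * 0"
      by (intro tendsto_intros lim q0)
    then show "(\<lambda>N. - (real N * q N) - 2 * (real N * q N) * q N) \<longlonglongrightarrow> - l" by simp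
    show "(\<lambda>N. - (real N * q N)) \<longlonglongrightarrow> - l" by (intro tendsto_intros lim)
  qed
  then have "(\<lambda>N. exp (real N * ln (1 - q N))) \<longlonglongrightarrow> exp (- l)"
    by (rule tendsto_exp)
  moreover have "\<forall>\<^sub>F N in sequentially. exp (real N * ln (1 - q N)) = (1 - q N) ^ N"
    using small by eventually_elim (simp add: exp_of_nat_mult)
  ultimately show "(\<lambda>N. (1 - q N) ^ N) \<longlonglongrightarrow> exp (- l)"
    by (rule Lim_transform_eventually)
qed

lemma tendsto_binomial_poisson:
  fixes q :: "nat \<Rightarrow> real"
  assumes q: "\<And>N. 0 \<le> q N" and lim: "(\<lambda>N. real N * q N) \<longlonglongrightarrow> l"
  shows "(\<lambda>N. real ((N - 1) choose k) * q N ^ k * (1 - q N) ^ (N - 1 - k)) \<longlonglongrightarrow> exp (- l) * l ^ k / fact k"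
proof -
  note q0 = tendsto_one_minus_power(2)[OF assms]
  \<comment> \<open>The power with exponent N - 1 - k is written as (1 - q)^N over (1 - q)^(k + 1);
    the exponent of the denominator is fixed, so the denominator tends to 1.\<close>
  have "(\<lambda>N. real ((N - 1) choose k) / real N ^ k * (real N * q N) ^ k * ((1 - q N) ^ N / (1 - q N) ^ (k + 1)))
      \<longlonglongrightarrow> 1 / fact k * l ^ k * (exp (- l) / (1 - 0) ^ (k + 1))"
    by (intro tendsto_intros tendsto_binomial_pred_scaled lim q0 tendsto_one_minus_power(1)[OF assms]) auto
  moreover have "\<forall>\<^sub>F N in sequentially. q N < 1"
    by (rule order_tendstoD(2)[OF q0]) simp
  then have "\<forall>\<^sub>F N in sequentially.
      real ((N - 1) choose k) / real N ^ k * (real N * q N) ^ k * ((1 - q N) ^ N / (1 - q N) ^ (k + 1))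
      = real ((N - 1) choose k) * q N ^ k * (1 - q N) ^ (N - 1 - k)"
    using eventually_ge_at_top[of "k + 1"]
  proof eventually_elim
    case (elim N)
    then have "(1 - q N) ^ N = (1 - q N) ^ (N - 1 - k) * (1 - q N) ^ (k + 1)"
      by (subst power_add[symmetric]) simp
    with elim show ?case by (simp add: power_mult_distrib)
  qed
  ultimately have "(\<lambda>N. real ((N - 1) choose k) * q N ^ k * (1 - q N) ^ (N - 1 - k))
      \<longlonglongrightarrow> 1 / fact k * l ^ k * (exp (- l) / (1 - 0) ^ (k + 1))"
    by (rule Lim_transform_eventually)
  then show ?thesis by (simp add: mult_ac)
qed

section \<open>Reduction to the depth of the vertex\<close>

lemma link_prob_bounds:
  assumes \<zeta>: "0 < \<zeta>" and \<alpha>: "0 < \<alpha>" and N: "2 \<le> N"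
  shows "0 \<le> link_prob \<zeta> \<alpha> \<beta> N y" "link_prob \<zeta> \<alpha> \<beta> N y \<le> 1"
proof -
  have "0 < disc_radius \<zeta> N"
    using \<zeta> N by (simp add: disc_radius_def)
  then interpret M: prob_space "point_law \<alpha> (disc_radius \<zeta> N)"
    by (intro prob_space_point_law \<alpha>)
  show "0 \<le> link_prob \<zeta> \<alpha> \<beta> N y"
    unfolding link_prob_def using edge_prob_bounds[THEN less_imp_le] by (intro integral_nonneg_AE) auto
  show "link_prob \<zeta> \<alpha> \<beta> N y \<le> 1"
    unfolding link_prob_def using edge_prob_bounds[THEN less_imp_le]
    by (intro M.integral_le_const M.integrable_const_bound[where B = 1]
        measurable_edge_prob[where f = "\<lambda>_. y" and g = "\<lambda>z. z"]) (auto simp: space_pair_measure sets_point_law)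
qed

lemma measurable_link_prob:
  assumes \<zeta>: "0 < \<zeta>" and \<alpha>: "0 < \<alpha>" and N: "2 \<le> N"
  shows "link_prob \<zeta> \<alpha> \<beta> N \<in> borel_measurable (borel \<Otimes>\<^sub>M borel)"
proof -
  have "0 < disc_radius \<zeta> N"
    using \<zeta> N by (simp add: disc_radius_def)
  then interpret M: prob_space "point_law \<alpha> (disc_radius \<zeta> N)"
    by (intro prob_space_point_law \<alpha>)
  have [measurable]: "snd \<in> (borel \<Otimes>\<^sub>M borel) \<Otimes>\<^sub>M point_law \<alpha> (disc_radius \<zeta> N) \<rightarrow>\<^sub>M borel \<Otimes>\<^sub>M borel"
    by (subst measurable_cong_sets[OF refl sets_point_law[symmetric]]) (rule measurable_snd)
  show ?thesis
    unfolding link_prob_def[abs_def]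
    by (rule M.borel_measurable_lebesgue_integral)
       (auto simp: split_beta' intro!: measurable_edge_prob measurable_fst)
qed

text \<open>The formula of \<open>link_prob_scaled\<close> does not contain the angle;
  \<open>pi\<close> serves as a reference value in [0, 2 \<pi>].\<close>

lemma link_prob_rotation:
  assumes \<zeta>: "0 < \<zeta>" and \<alpha>: "0 < \<alpha>" and N: "2 \<le> N" and \<theta>: "0 \<le> \<theta>" "\<theta> \<le> 2 * pi"
  shows "link_prob \<zeta> \<alpha> \<beta> N (r, \<theta>) = link_prob \<zeta> \<alpha> \<beta> N (r, pi)"
proof -
  have "ennreal (real N * link_prob \<zeta> \<alpha> \<beta> N (r, \<theta>)) = ennreal (real N * link_prob \<zeta> \<alpha> \<beta> N (r, pi))"
    using link_prob_scaled[OF \<zeta> \<alpha> N \<theta>, of \<beta> "disc_radius \<zeta> N - r"]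
      link_prob_scaled[OF \<zeta> \<alpha> N, of pi \<beta> "disc_radius \<zeta> N - r"] by simp
  then show ?thesis
    using N link_prob_bounds[OF \<zeta> \<alpha> N] by (subst (asm) ennreal_inj) auto
qed

text \<open>Supplies the constant majorant for the dominated convergence in the depth of the
  vertex.\<close>

lemma binomial_prob_le_1:
  fixes p :: real
  assumes "0 \<le> p" "p \<le> 1"
  shows "real (n choose k) * p ^ k * (1 - p) ^ (n - k) \<le> 1"
  using pmf_le_1[of "binomial_pmf n p" k] assms by (simp add: pmf_binomial)

text \<open>By rotation invariance the integrand is constant in the angle, so the uniform law
  integrates out and only the depth t = R - r remains.\<close>

lemma emeasure_vertex_degree_radial:
  fixes \<zeta> \<alpha> \<beta> :: real
  assumes \<zeta>: "0 < \<zeta>" and \<alpha>: "0 < \<alpha>" and N: "2 \<le> N" and u: "u < N"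
  defines "R \<equiv> disc_radius \<zeta> N"
  defines "q \<equiv> \<lambda>t. link_prob \<zeta> \<alpha> \<beta> N (R - t, pi)"
  shows "emeasure (hyp_graph \<zeta> \<alpha> \<beta> N) {g. vertex_degree N u g = k}
           = (\<integral>\<^sup>+t. ennreal (radial_density \<alpha> R (R - t)) *
                ennreal (real ((N - 1) choose k) * q t ^ k * (1 - q t) ^ (N - 1 - k)) \<partial>lborel)"
proof -
  let ?b = "\<lambda>p. ennreal (real ((N - 1) choose k) * p ^ k * (1 - p) ^ (N - 1 - k))"
  have b[measurable]: "(\<lambda>x. ?b (link_prob \<zeta> \<alpha> \<beta> N (f x))) \<in> borel_measurable L"
    if "f \<in> L \<rightarrow>\<^sub>M borel \<Otimes>\<^sub>M borel" for f and L :: "'x measure"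
  proof -
    have [measurable]: "(\<lambda>x. link_prob \<zeta> \<alpha> \<beta> N (f x)) \<in> borel_measurable L"
      by (rule measurable_compose[OF that measurable_link_prob[OF \<zeta> \<alpha> N]])
    show ?thesis by measurable
  qed
  have "emeasure (hyp_graph \<zeta> \<alpha> \<beta> N) {g. vertex_degree N u g = k}
      = (\<integral>\<^sup>+y. ?b (link_prob \<zeta> \<alpha> \<beta> N y) \<partial>point_law \<alpha> R)"
    unfolding link_prob_def R_def by (rule emeasure_vertex_degree[OF \<zeta> \<alpha> N u])
  also have "\<dots> = (\<integral>\<^sup>+r. ennreal (radial_density \<alpha> R r) * (ennreal (1 / (2 * pi)) *
      (\<integral>\<^sup>+\<theta>. ?b (link_prob \<zeta> \<alpha> \<beta> N (r, \<theta>)) * indicator {0<..2 * pi} \<theta> \<partial>lborel)) \<partial>lborel)"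
    by (rule nn_integral_point_law[OF \<alpha>]) (rule b, simp)
  also have "\<dots> = (\<integral>\<^sup>+r. ennreal (radial_density \<alpha> R r) * ?b (link_prob \<zeta> \<alpha> \<beta> N (r, pi)) \<partial>lborel)"
  proof (intro nn_integral_cong arg_cong2[where f = times] refl)
    fix r
    have "(\<integral>\<^sup>+\<theta>. ?b (link_prob \<zeta> \<alpha> \<beta> N (r, \<theta>)) * indicator {0<..2 * pi} \<theta> \<partial>lborel)
        = (\<integral>\<^sup>+\<theta>. ?b (link_prob \<zeta> \<alpha> \<beta> N (r, pi)) * indicator {0<..2 * pi} \<theta> \<partial>lborel)"
    proof (rule nn_integral_cong)
      fix \<theta>
      show "?b (link_prob \<zeta> \<alpha> \<beta> N (r, \<theta>)) * indicator {0<..2 * pi} \<theta>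
          = ?b (link_prob \<zeta> \<alpha> \<beta> N (r, pi)) * indicator {0<..2 * pi} \<theta>"
        using link_prob_rotation[OF \<zeta> \<alpha> N, of \<theta> \<beta> r] by (cases "\<theta> \<in> {0<..2 * pi}") auto
    qed
    also have "\<dots> = ?b (link_prob \<zeta> \<alpha> \<beta> N (r, pi)) * ennreal (2 * pi)"
      by (subst nn_integral_cmult_indicator) auto
    also have "ennreal (1 / (2 * pi)) * \<dots> = (ennreal (1 / (2 * pi)) * ennreal (2 * pi)) * ?b (link_prob \<zeta> \<alpha> \<beta> N (r, pi))"
      by (simp only: mult_ac)
    also have "ennreal (1 / (2 * pi)) * ennreal (2 * pi) = 1"
      by (subst ennreal_mult'[symmetric]) auto
    finally show "ennreal (1 / (2 * pi)) * (\<integral>\<^sup>+\<theta>. ?b (link_prob \<zeta> \<alpha> \<beta> N (r, \<theta>)) * indicator {0<..2 * pi} \<theta> \<partial>lborel)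
        = ?b (link_prob \<zeta> \<alpha> \<beta> N (r, pi))" by simp
  qed
  also have "\<dots> = (\<integral>\<^sup>+t. ennreal (radial_density \<alpha> R (R - t)) * ?b (link_prob \<zeta> \<alpha> \<beta> N (R - t, pi)) \<partial>lborel)"
    by (rule nn_integral_lborel_reflect[symmetric]) measurable
  finally show ?thesis
    unfolding q_def .
qed

text \<open>At fixed depth t the binomial weights tend to Poisson weights of mean K exp (\<zeta> t /
  2), and the radial density tends to the exponential one. As binomial weights are at most 1, the
  radial majorant dominates the product.\<close>

lemma tendsto_emeasure_vertex_degree:
  fixes u :: "nat \<Rightarrow> nat"
  assumes \<zeta>: "0 < \<zeta>" and \<alpha>: "0 < \<alpha>" and \<beta>: "1 < \<beta>" and ratio: "\<zeta> < 2 * \<alpha>"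
    and u: "\<And>N. 1 \<le> N \<Longrightarrow> u N < N"
  defines "K \<equiv> 4 * \<alpha> / (2 * \<alpha> - \<zeta>) * (1 / \<beta>) * (1 / sin (pi / \<beta>))"
  shows "(\<lambda>N. emeasure (hyp_graph \<zeta> \<alpha> \<beta> N) {g. vertex_degree N (u N) g = k}) \<longlonglongrightarrow>
           (\<integral>\<^sup>+t. ennreal (exp (- (K * exp (\<zeta> * t / 2))) * (K * exp (\<zeta> * t / 2)) ^ k / fact k)
              \<partial>density lborel (exponential_density \<alpha>))"
proof -
  define R where "R = disc_radius \<zeta>"
  \<comment> \<open>The value 0 for \<open>N < 2\<close>, where the disc degenerates, keeps bounds,
    measurability and the hypotheses of the Poisson limit valid at every \<open>N\<close>.\<close>
  define q where "q N t = (if 2 \<le> N then link_prob \<zeta> \<alpha> \<beta> N (R N - t, pi) else 0)" for N t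
  have lim_R: "filterlim R at_top sequentially"
    unfolding R_def by (rule filterlim_disc_radius[OF \<zeta>])
  from eventually_exp_disc_radius_small[OF \<zeta> \<alpha>]
  obtain n where n: "\<And>N. n \<le> N \<Longrightarrow> exp (- (\<alpha> * R N)) \<le> 1 / 2" "\<And>N. n \<le> N \<Longrightarrow> 2 \<le> N"
    unfolding eventually_sequentially R_def by blast
  have q01: "0 \<le> q N t" "q N t \<le> 1" for N t
    by (auto simp: q_def link_prob_bounds[OF \<zeta> \<alpha>])
  have q_meas[measurable]: "q N \<in> borel_measurable borel" for N
  proof (cases "2 \<le> N")
    case True
    note [measurable] = measurable_link_prob[OF \<zeta> \<alpha> True]
    show ?thesis using True unfolding q_def[abs_def] by simp measurable
  qed (simp add: q_def[abs_def])
  have q_lim: "(\<lambda>N. real N * q N t) \<longlonglongrightarrow> K * exp (\<zeta> * t / 2)" for t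
    unfolding K_def
    by (rule Lim_transform_eventually[OF tendsto_link_prob[OF \<zeta> \<alpha> \<beta> ratio, of pi t]
          eventually_mono[OF eventually_ge_at_top[of 2]]]) (auto simp: q_def R_def)
  let ?b = "\<lambda>N t. real ((N - 1) choose k) * q N t ^ k * (1 - q N t) ^ (N - 1 - k)"
  let ?p = "\<lambda>t. exp (- (K * exp (\<zeta> * t / 2))) * (K * exp (\<zeta> * t / 2)) ^ k / fact k"
  have b1: "ennreal (?b N t) \<le> 1" for N t
    using binomial_prob_le_1[OF q01, of "N - 1" k N t] by (simp only: ennreal_le_1)
  have "(\<lambda>N. \<integral>\<^sup>+t. ennreal (radial_density \<alpha> (R (N + n)) (R (N + n) - t)) * ennreal (?b (N + n) t) \<partial>lborel)
      \<longlonglongrightarrow> (\<integral>\<^sup>+t. ennreal (\<alpha> * exp (- (\<alpha> * t)) * indicator {0..} t) * ennreal (?p t) \<partial>lborel)"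
  proof (rule nn_integral_dominated_convergence[where w = "\<lambda>t. ennreal (4 * \<alpha> * exp (- (\<alpha> * t)) * indicator {0..} t) * 1"])
    show "AE t in lborel. ennreal (radial_density \<alpha> (R (N + n)) (R (N + n) - t)) * ennreal (?b (N + n) t)
        \<le> ennreal (4 * \<alpha> * exp (- (\<alpha> * t)) * indicator {0..} t) * 1" for N
      by (intro AE_I2 mult_mono ennreal_leI radial_density_le \<alpha> n b1) auto
    have "(\<integral>\<^sup>+t. ennreal (4 * \<alpha> * exp (- (\<alpha> * t)) * indicator {0..} t) * 1 \<partial>lborel)
        = (\<integral>\<^sup>+t. ennreal (4 * \<alpha>) * (ennreal (exp (- (\<alpha> * t))) * indicator {0..} t) \<partial>lborel)"
      using \<alpha> by (intro nn_integral_cong) (auto simp: ennreal_mult' split: split_indicator)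
    also have "\<dots> < \<infinity>"
      using \<alpha> by (subst nn_integral_cmult) (auto simp: nn_integral_exp_neg_Ici ennreal_mult_less_top)
    finally show "(\<integral>\<^sup>+t. ennreal (4 * \<alpha> * exp (- (\<alpha> * t)) * indicator {0..} t) * 1 \<partial>lborel) < \<infinity>" .
    show "AE t in lborel. (\<lambda>N. ennreal (radial_density \<alpha> (R (N + n)) (R (N + n) - t)) * ennreal (?b (N + n) t))
        \<longlonglongrightarrow> ennreal (\<alpha> * exp (- (\<alpha> * t)) * indicator {0..} t) * ennreal (?p t)"
    proof (rule AE_I2)
      fix t
      have "(\<lambda>N. ennreal (?b N t)) \<longlonglongrightarrow> ennreal (?p t)"
        by (intro tendsto_ennrealI tendsto_binomial_poisson q01 q_lim)
      moreover have "(\<lambda>N. ennreal (radial_density \<alpha> (R N) (R N - t))) \<longlonglongrightarrow> ennreal (\<alpha> * exp (- (\<alpha> * t)) * indicator {0..} t)"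
        by (intro tendsto_ennrealI tendsto_radial_density[OF \<alpha> lim_R])
      ultimately have "(\<lambda>N. ennreal (radial_density \<alpha> (R N) (R N - t)) * ennreal (?b N t))
        \<longlonglongrightarrow> ennreal (\<alpha> * exp (- (\<alpha> * t)) * indicator {0..} t) * ennreal (?p t)"
        by (intro tendsto_mult_ennreal) auto
      then show "(\<lambda>N. ennreal (radial_density \<alpha> (R (N + n)) (R (N + n) - t)) * ennreal (?b (N + n) t))
        \<longlonglongrightarrow> ennreal (\<alpha> * exp (- (\<alpha> * t)) * indicator {0..} t) * ennreal (?p t)"
        by (rule LIMSEQ_ignore_initial_segment)
    qed
  qed measurable
  moreover have "(\<integral>\<^sup>+t. ennreal (radial_density \<alpha> (R (N + n)) (R (N + n) - t)) * ennreal (?b (N + n) t) \<partial>lborel)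
      = emeasure (hyp_graph \<zeta> \<alpha> \<beta> (N + n)) {g. vertex_degree (N + n) (u (N + n)) g = k}" for N
  proof -
    have N: "2 \<le> N + n" using n(2)[of "N + n"] by simp
    then have "u (N + n) < N + n" using u[of "N + n"] by simp
    then show ?thesis
      using emeasure_vertex_degree_radial[OF \<zeta> \<alpha> N, of "u (N + n)" \<beta> k] N by (simp add: q_def R_def)
  qed
  moreover have "(\<integral>\<^sup>+t. ennreal (\<alpha> * exp (- (\<alpha> * t)) * indicator {0..} t) * ennreal (?p t) \<partial>lborel)
      = (\<integral>\<^sup>+t. ennreal (?p t) \<partial>density lborel (exponential_density \<alpha>))"
    by (subst nn_integral_density)
       (auto simp: exponential_density_def mult_ac intro!: nn_integral_cong split: split_indicator)
  ultimately show ?thesis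
    by (simp only:) (rule LIMSEQ_offset[of _ n])
qed

section \<open>The Pareto-mixed Poisson distribution\<close>

text \<open>A distribution function determines its measure. Monotonicity, right continuity and the
  limits of \<open>F\<close> are inherited from \<open>cdf M\<close>.\<close>

lemma interval_measure_eqI:
  assumes "real_distribution M" and "\<And>x. cdf M x = F x"
  shows "interval_measure F = M"
proof -
  interpret real_distribution M by fact
  have "interval_measure (cdf M) = M"
    by (rule cdf_unique[OF real_distribution_interval_measure assms(1) cdf_interval_measure])
       (auto intro: cdf_nondecreasing cdf_is_right_cont cdf_lim_at_bot cdf_lim_at_top_prob)
  moreover have "cdf M = F"
    using assms(2) by (rule ext)
  ultimately show ?thesis by simp
qed

lemma powr_ratio_eq:
  fixes K x :: real
  assumes "0 < K" "0 < x"
  shows "(K / x) powr a = exp (- (a * ln (x / K)))"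
  using assms by (simp add: powr_def ln_div algebra_simps)

text \<open>If T is exponential with rate \<alpha> and x \<ge> K, then K exp (\<zeta> T / 2) exceeds
  x exactly when T exceeds (2 / \<zeta>) ln (x / K), which has probability (K / x)^(2 \<alpha> /
  \<zeta>).\<close>

lemma interval_measure_pareto_exponential:
  fixes \<zeta> \<alpha> K :: real
  assumes \<zeta>: "0 < \<zeta>" and \<alpha>: "0 < \<alpha>" and K: "0 < K"
    and F: "\<And>t. F t = (if K \<le> t then 1 - (K / t) powr (2 * \<alpha> / \<zeta>) else 0)"
  shows "interval_measure F
           = distr (density lborel (exponential_density \<alpha>)) borel (\<lambda>t. K * exp (\<zeta> * t / 2))"
proof (rule interval_measure_eqI)
  let ?D = "density lborel (exponential_density \<alpha>)"
  let ?h = "\<lambda>t. K * exp (\<zeta> * t / 2)"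
  interpret D: prob_space ?D
    by (rule prob_space_exponential_density[OF \<alpha>])
  show "real_distribution (distr ?D borel ?h)"
    by (rule D.real_distribution_distr) auto
  have dist: "distributed ?D lborel (\<lambda>t. t) (exponential_density \<alpha>)"
    by (auto simp: distributed_def intro!: distr_id2)
  have le: "measure ?D {t. t \<le> a} = 1 - exp (- a * \<alpha>)" if "0 \<le> a" for a
    using D.exponential_distributedD_le[OF dist that \<alpha>] by simp
  fix x
  have cdf: "cdf (distr ?D borel ?h) x = measure ?D {t. ?h t \<le> x}"
    by (simp add: cdf_def measure_distr vimage_def)
  show "cdf (distr ?D borel ?h) x = F x"
  proof (cases "K \<le> x")
    case True
    then have x: "0 < x" using K by simp
    have "?h t \<le> x \<longleftrightarrow> t \<le> 2 / \<zeta> * ln (x / K)" for t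
    proof -
      have "?h t \<le> x \<longleftrightarrow> exp (\<zeta> * t / 2) \<le> x / K"
        using K by (simp add: field_simps)
      also have "\<dots> \<longleftrightarrow> \<zeta> * t / 2 \<le> ln (x / K)"
        using K x by (subst ln_ge_iff) auto
      also have "\<dots> \<longleftrightarrow> t \<le> 2 / \<zeta> * ln (x / K)"
        using \<zeta> by (simp add: field_simps)
      finally show ?thesis .
    qed
    then have "cdf (distr ?D borel ?h) x = measure ?D {t. t \<le> 2 / \<zeta> * ln (x / K)}"
      by (simp add: cdf)
    also have "\<dots> = 1 - exp (- (2 / \<zeta> * ln (x / K)) * \<alpha>)"
      using True K \<zeta> by (intro le) simp
    also have "\<dots> = F x"
      using True powr_ratio_eq[OF K x, of "2 * \<alpha> / \<zeta>"] by (simp add: F mult_ac)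
    finally show ?thesis .
  next
    case False
    \<comment> \<open>Below \<open>K\<close> only nonpositive values of the exponential variable are
      left, and they carry no mass.\<close>
    have "{t. ?h t \<le> x} \<subseteq> {t. t \<le> 0}"
    proof safe
      fix t assume "?h t \<le> x"
      with False have "K * exp (\<zeta> * t / 2) < K * 1" by simp
      then have "exp (\<zeta> * t / 2) < 1" using K by (simp only: mult_less_cancel_left_pos)
      then show "t \<le> 0" using \<zeta> by (simp add: mult_less_0_iff)
    qed
    then have "measure ?D {t. ?h t \<le> x} \<le> measure ?D {t. t \<le> 0}"
      by (intro D.finite_measure_mono) auto
    then show ?thesis
      using le[of 0] False by (simp add: cdf F measure_le_0_iff)
  qed
qed

text \<open>The derivative of 1 - (K / x)^a for x > 0; the restriction to x \<ge> K is added where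
  the density is used.\<close>

definition pareto_density :: "real \<Rightarrow> real \<Rightarrow> real \<Rightarrow> real" where
  "pareto_density K a x = a * K powr a * x powr (- (a + 1))"

lemma pareto_density_nonneg: "0 \<le> a \<Longrightarrow> 0 \<le> pareto_density K a x"
  by (simp add: pareto_density_def)

lemma measurable_pareto_density [measurable]: "pareto_density K a \<in> borel_measurable borel"
  unfolding pareto_density_def[abs_def] by measurable

lemma pareto_antiderivative:
  assumes "0 < K" "0 < x"
  shows "((\<lambda>x. - ((K / x) powr a)) has_real_derivative pareto_density K a x) (at x)"
proof -
  have "((\<lambda>x. - (K powr a * x powr (- a))) has_real_derivative - (K powr a * (- a * x powr (- a - 1)))) (at x)"
    using assms by (auto intro!: derivative_eq_intros)
  also have "- (K powr a * (- a * x powr (- a - 1))) = pareto_density K a x"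
    by (simp add: pareto_density_def minus_diff_commute[of a 1])
  finally show ?thesis
  proof (rule has_field_derivative_transform_within_open[where S = "{0<..}"])
    show "- (K powr a * y powr (- a)) = - ((K / y) powr a)" if "y \<in> {0<..}" for y
      using that assms by (simp add: powr_divide powr_minus_divide)
  qed (use assms in auto)
qed

text \<open>A second description of the mixing law: the exponential one fits the limit of the
  degrees, this one turns the mixed weights into incomplete Gamma integrals.\<close>

lemma interval_measure_pareto_density:
  assumes K: "0 < K" and a: "0 < a"
    and F: "\<And>t. F t = (if K \<le> t then 1 - (K / t) powr a else 0)"
  shows "interval_measure F = density lborel (\<lambda>x. ennreal (pareto_density K a x) * indicator {K..} x)"
proof (rule interval_measure_eqI)
  let ?f = "\<lambda>x. ennreal (pareto_density K a x)"
  let ?D = "density lborel (\<lambda>x. ?f x * indicator {K..} x)"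
  have "(\<integral>\<^sup>+x. ?f x * indicator {K..} x \<partial>lborel) = ennreal (0 - - ((K / K) powr a))"
  proof (rule nn_integral_FTC_atLeast[where F = "\<lambda>x. - ((K / x) powr a)"])
    show "((\<lambda>x. - ((K / x) powr a)) \<longlongrightarrow> 0) at_top"
      using K a by real_asymp
  qed (use K a in \<open>auto intro: pareto_antiderivative pareto_density_nonneg\<close>)
  then have "emeasure ?D (space ?D) = 1"
    using K by (simp add: emeasure_density)
  then interpret D: prob_space ?D by (rule prob_spaceI)
  show "real_distribution ?D"
    by standard auto
  fix x
  show "cdf ?D x = F x"
  proof (cases "K \<le> x")
    case True
    have "emeasure ?D {..x} = (\<integral>\<^sup>+y. ?f y * indicator {K..x} y \<partial>lborel)"
      by (subst emeasure_density) (auto intro!: nn_integral_cong split: split_indicator)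
    also have "\<dots> = ennreal (- ((K / x) powr a) - - ((K / K) powr a))"
      using True K a by (intro nn_integral_FTC_Icc[where F = "\<lambda>x. - ((K / x) powr a)"]) (auto intro: pareto_antiderivative pareto_density_nonneg)
    finally have "ennreal (measure ?D {..x}) = ennreal (F x)"
      using True K by (simp add: D.emeasure_eq_measure F)
    moreover have "0 \<le> F x"
      using True K a by (simp add: F powr_le1)
    ultimately show ?thesis
      by (simp add: cdf_def)
  next
    case False
    have "emeasure ?D {..x} = (\<integral>\<^sup>+y. ?f y * indicator {K..} y * indicator {..x} y \<partial>lborel)"
      by (rule emeasure_density) auto
    also have "\<dots> = (\<integral>\<^sup>+y. 0 \<partial>(lborel :: real measure))"
      using False by (intro nn_integral_cong) (auto split: split_indicator)
    finally show ?thesis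
      using False by (simp add: cdf_def measure_def F)
  qed
qed

section \<open>Poisson weights and quotients of Gamma values and factorials\<close>

lemma poisson_weight_bounds:
  fixes t :: real
  assumes "0 \<le> t"
  shows "0 \<le> exp (- t) * t ^ k / fact k" "exp (- t) * t ^ k / fact k \<le> 1"
proof -
  show "0 \<le> exp (- t) * t ^ k / fact k" using assms by simp
  show "exp (- t) * t ^ k / fact k \<le> 1"
  proof (cases "t = 0")
    case False
    then show ?thesis
      using pmf_le_1[of "poisson_pmf t" k] assms by (simp add: mult_ac)
  qed (cases k; simp)
qed

lemma poisson_weight_sums:
  fixes t :: real
  shows "(\<lambda>k. exp (- t) * t ^ k / fact k) sums 1"
proof -
  have "(\<lambda>k. exp (- t) * (t ^ k /\<^sub>R fact k)) sums (exp (- t) * exp t)"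
    by (intro sums_mult exp_converges)
  then show ?thesis
    by (simp add: divide_inverse mult_ac flip: exp_add)
qed

text \<open>This is the limit formula Gamma z = lim \<open>Gamma_series z n\<close> at z = m - a.
  With k = n + m + 1, the quotient of Gamma z by the n-th term is Gamma (k - a) / (n! n^z).\<close>

lemma Gamma_fact_ratio_tendsto:
  fixes a :: real
  assumes "0 < a"
  shows "(\<lambda>k. Gamma (real k - a) / fact k * real k powr (a + 1)) \<longlonglongrightarrow> 1"
proof -
  \<comment> \<open>Shifting by \<open>m\<close> moves the argument off the poles of \<open>Gamma\<close>, which matters when \<open>a\<close> is an integer.\<close>
  define m where "m = nat \<lceil>a\<rceil> + 1"
  define z where "z = real m - a"
  have z: "0 < z"
    unfolding z_def m_def by linarith
  have G: "Gamma z > 0" using z by (rule Gamma_real_pos)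
  have "(\<lambda>n. Gamma z / Gamma_series z n) \<longlonglongrightarrow> Gamma z / Gamma z"
    using G by (intro tendsto_intros Gamma_series_LIMSEQ) auto
  then have l1: "(\<lambda>n. Gamma z / Gamma_series z n) \<longlonglongrightarrow> 1"
    using G by simp
  \<comment> \<open>With k = n + m + 1 this factor equals k^(a + 1) n! n^z / k!, which converts the
    quotient into the one claimed; it consists of a fixed number of ratios tending to 1.\<close>
  have "(\<lambda>n. (real (n + m + 1) / real n) powr (a + 1) * (\<Prod>i=0..<m + 1. real n / (real n + 1 + real i)))
      \<longlonglongrightarrow> 1 powr (a + 1) * (\<Prod>i=0..<m + 1. 1)"
  proof (intro tendsto_intros tendsto_prod)
    show "(\<lambda>n. real (n + m + 1) / real n) \<longlonglongrightarrow> 1" by real_asymp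
    show "(\<lambda>n. real n / (real n + 1 + real i)) \<longlonglongrightarrow> 1" for i by real_asymp
  qed auto
  then have l2: "(\<lambda>n. (real (n + m + 1) / real n) powr (a + 1) * (\<Prod>i=0..<m + 1. real n / (real n + 1 + real i))) \<longlonglongrightarrow> 1"
    by simp
  have eq: "(Gamma z / Gamma_series z n) * ((real (n + m + 1) / real n) powr (a + 1) * (\<Prod>i=0..<m + 1. real n / (real n + 1 + real i)))
      = Gamma (real (n + (m + 1)) - a) / fact (n + (m + 1)) * real (n + (m + 1)) powr (a + 1)" if n: "0 < n" for n
  proof -
    have "pochhammer z (n + 1) = Gamma (z + real (n + 1)) / Gamma z"
      using z by (intro pochhammer_Gamma) (auto elim!: nonpos_Ints_cases)
    then have *: "Gamma z / Gamma_series z n = Gamma (real (n + (m + 1)) - a) / (fact n * real n powr z)"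
      using n G by (simp add: Gamma_series_def powr_def z_def field_simps)
    have "fact (n + (m + 1)) = (fact n * pochhammer (real n + 1) (m + 1) :: real)"
      by (simp only: pochhammer_fact pochhammer_product'[of 1 n] add.commute)
    then have f: "(\<Prod>i=0..<m + 1. real n + 1 + real i) = fact (n + (m + 1)) / fact n"
      by (simp add: pochhammer_prod)
    have p: "(\<Prod>i=0..<m + 1. real n / (real n + 1 + real i)) = real n ^ (m + 1) * fact n / fact (n + (m + 1))"
      by (simp only: prod_dividef f) simp
    have pw: "real n ^ (m + 1) = real n powr z * real n powr (a + 1)"
    proof -
      have "real n ^ (m + 1) = real n powr real (m + 1)"
        using n by (subst powr_realpow) auto
      also have "real (m + 1) = z + (a + 1)"
        by (simp add: z_def)
      finally show ?thesis by (simp only: powr_add)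
    qed
    show ?thesis
      unfolding * p pw using n by (simp add: powr_divide add_ac)
  qed
  have "(\<lambda>n. (Gamma z / Gamma_series z n) * ((real (n + m + 1) / real n) powr (a + 1) * (\<Prod>i=0..<m + 1. real n / (real n + 1 + real i)))) \<longlonglongrightarrow> 1 * 1"
    by (rule tendsto_mult[OF l1 l2])
  then have "(\<lambda>n. Gamma (real (n + (m + 1)) - a) / fact (n + (m + 1)) * real (n + (m + 1)) powr (a + 1)) \<longlonglongrightarrow> 1 * 1"
    by (rule Lim_transform_eventually[OF _ eventually_mono[OF eventually_gt_at_top[of 0] eq]])
  then show ?thesis
    unfolding mult_1 by (rule LIMSEQ_offset)
qed


section \<open>The mixed Poisson weights and their decay\<close>

lemma AE_pareto_pos:
  assumes K: "0 < K" and a: "0 < a"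
    and F: "\<And>t. F t = (if K \<le> t then 1 - (K / t) powr a else 0)"
  shows "AE t in interval_measure F. 0 < t"
  unfolding interval_measure_pareto_density[OF assms]
  using K by (subst AE_density) (auto split: split_indicator)

lemma real_distribution_pareto:
  assumes K: "0 < K" and a: "0 < a"
    and F: "\<And>t. F t = (if K \<le> t then 1 - (K / t) powr a else 0)"
  shows "real_distribution (interval_measure F)"
proof -
  \<comment> \<open>With \<zeta> = 1 and \<alpha> = a / 2 the exponent 2 \<alpha> / \<zeta> is
    a.\<close>
  have "interval_measure F = distr (density lborel (exponential_density (a / 2))) borel (\<lambda>t. K * exp (1 * t / 2))"
    by (rule interval_measure_pareto_exponential) (use assms in auto)
  then show ?thesis
    using prob_space.real_distribution_distr[OF prob_space_exponential_density[of "a / 2"], of "\<lambda>t. K * exp (1 * t / 2)"] a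
    by simp
qed

lemma nn_integral_poisson_pareto:
  assumes K: "0 < K" and a: "0 < a"
    and F: "\<And>t. F t = (if K \<le> t then 1 - (K / t) powr a else 0)"
  shows "(\<integral>\<^sup>+t. ennreal (exp (- t) * t ^ k / fact k) \<partial>interval_measure F)
           = ennreal (LINT t|interval_measure F. exp (- t) * t ^ k / fact k)"
    and "0 \<le> (LINT t|interval_measure F. exp (- t) * t ^ k / fact k)"
proof -
  interpret real_distribution "interval_measure F"
    by (rule real_distribution_pareto[OF assms])
  \<comment> \<open>For odd \<open>k\<close> the integrand is negative at negative \<open>t\<close>;
    positivity of the mixing variable excludes this.\<close>
  have nonneg: "AE t in interval_measure F. 0 \<le> exp (- t) * t ^ k / fact k"
    using AE_pareto_pos[OF assms] by eventually_elim simp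
  then show "0 \<le> (LINT t|interval_measure F. exp (- t) * t ^ k / fact k)"
    by (rule integral_nonneg_AE)
  have "integrable (interval_measure F) (\<lambda>t. exp (- t) * t ^ k / fact k)"
  proof (rule integrable_const_bound[where B = 1])
    show "AE t in interval_measure F. norm (exp (- t) * t ^ k / fact k) \<le> 1"
      using AE_pareto_pos[OF assms]
    proof eventually_elim
      case (elim t)
      then show ?case using poisson_weight_bounds[of t k] by simp
    qed
  qed simp
  then show "(\<integral>\<^sup>+t. ennreal (exp (- t) * t ^ k / fact k) \<partial>interval_measure F)
           = ennreal (LINT t|interval_measure F. exp (- t) * t ^ k / fact k)"
    using nonneg by (rule nn_integral_eq_integral)
qed

text \<open>Sum and integral are interchanged, and the Poisson weights sum to 1 for each t. No mass
  is lost in the limit, which is the tightness behind the joint limit in k and N.\<close>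

lemma poisson_pareto_sums:
  assumes K: "0 < K" and a: "0 < a"
    and F: "\<And>t. F t = (if K \<le> t then 1 - (K / t) powr a else 0)"
  shows "(\<lambda>k. LINT t|interval_measure F. exp (- t) * t ^ k / fact k) sums 1"
proof -
  interpret real_distribution "interval_measure F"
    by (rule real_distribution_pareto[OF assms])
  let ?p = "\<lambda>k. LINT t|interval_measure F. exp (- t) * t ^ k / fact k"
  have "(\<Sum>k. ennreal (?p k)) = (\<Sum>k. \<integral>\<^sup>+t. ennreal (exp (- t) * t ^ k / fact k) \<partial>interval_measure F)"
    by (simp only: nn_integral_poisson_pareto(1)[OF assms])
  also have "\<dots> = (\<integral>\<^sup>+t. (\<Sum>k. ennreal (exp (- t) * t ^ k / fact k)) \<partial>interval_measure F)"
    by (rule nn_integral_suminf[symmetric]) simp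
  also have "\<dots> = (\<integral>\<^sup>+t. 1 \<partial>interval_measure F)"
  proof (rule nn_integral_cong_AE)
    show "AE t in interval_measure F. (\<Sum>k. ennreal (exp (- t) * t ^ k / fact k)) = 1"
      using AE_pareto_pos[OF assms]
    proof eventually_elim
      case (elim t)
      then have "(\<Sum>k. ennreal (exp (- t) * t ^ k / fact k)) = ennreal (\<Sum>k. exp (- t) * t ^ k / fact k)"
        using sums_summable[OF poisson_weight_sums[of t]] by (intro suminf_ennreal2) auto
      then show ?case
        using sums_unique[OF poisson_weight_sums[of t]] by simp
    qed
  qed
  also have "\<dots> = 1"
    using emeasure_space_1 by simp
  finally have "(\<Sum>k. ennreal (?p k)) = ennreal 1" by simp
  moreover have "(\<lambda>k. ennreal (?p k)) sums (\<Sum>k. ennreal (?p k))"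
    by (rule summable_sums) simp
  ultimately have "(\<lambda>n. \<Sum>k<n. ennreal (?p k)) \<longlonglongrightarrow> ennreal 1"
    by (simp add: sums_def)
  then have "(\<lambda>n. ennreal (\<Sum>k<n. ?p k)) \<longlonglongrightarrow> ennreal 1"
    using nn_integral_poisson_pareto(2)[OF assms] by (simp add: sum_ennreal)
  then show ?thesis
    using nn_integral_poisson_pareto(2)[OF assms]
    by (subst (asm) tendsto_ennreal_iff) (auto simp: sums_def intro!: always_eventually sum_nonneg)
qed

text \<open>Under the Pareto density the weight is a K^a / k! times the integral of x^(k - a - 1)
  exp (- x) over x \<ge> K. The part missing from Gamma (k - a) lies over [0, K), where k \<ge> a +
  1 makes the integrand at most K^(k - a - 1).\<close>

lemma poisson_pareto_between:
  assumes K: "0 < K" and a: "0 < a"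
    and F: "\<And>t. F t = (if K \<le> t then 1 - (K / t) powr a else 0)"
    and k: "a + 1 \<le> real k"
  shows "(LINT t|interval_measure F. exp (- t) * t ^ k / fact k)
           \<in> {a * K powr a / fact k * (Gamma (real k - a) - K powr (real k - a)) ..
              a * K powr a / fact k * Gamma (real k - a)}"
proof -
  let ?p = "LINT t|interval_measure F. exp (- t) * t ^ k / fact k"
  define g where "g x = x powr (real k - a - 1) / exp x" for x :: real
  define A where "A = (\<integral>\<^sup>+x. ennreal (g x) * indicator {0..<K} x \<partial>lborel)"
  define B where "B = (\<integral>\<^sup>+x. ennreal (g x) * indicator {K..} x \<partial>lborel)"
  have g: "0 \<le> g x" for x by (simp add: g_def)
  have [measurable]: "g \<in> borel_measurable borel"
    unfolding g_def[abs_def] by measurable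
  have "ennreal (Gamma (real k - a)) = (\<integral>\<^sup>+x. ennreal (g x) * indicator {0..<K} x + ennreal (g x) * indicator {K..} x \<partial>lborel)"
    using k K by (subst Gamma_conv_nn_integral_real)
      (auto simp: g_def intro!: nn_integral_cong split: split_indicator)
  then have AB: "ennreal (Gamma (real k - a)) = A + B"
    by (simp add: A_def B_def nn_integral_add)
  have "A \<le> (\<integral>\<^sup>+x. ennreal (K powr (real k - a - 1)) * indicator {0..<K} x \<partial>lborel)"
    unfolding A_def
  proof (rule nn_integral_mono)
    fix x :: real
    show "ennreal (g x) * indicator {0..<K} x \<le> ennreal (K powr (real k - a - 1)) * indicator {0..<K} x"
    proof (cases "x \<in> {0..<K}")
      case True
      have "g x \<le> x powr (real k - a - 1) / 1"
        unfolding g_def using True by (intro divide_left_mono) auto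
      also have "\<dots> \<le> K powr (real k - a - 1)"
        using True k by (auto intro!: powr_mono2)
      finally show ?thesis
        using True by (auto intro!: ennreal_leI)
    qed simp
  qed
  also have "\<dots> = ennreal (K powr (real k - a - 1) * K)"
    using K by (subst nn_integral_cmult_indicator) (auto simp: ennreal_mult)
  also have "K powr (real k - a - 1) * K = K powr (real k - a)"
    using K by (simp add: powr_diff)
  finally have A: "A \<le> ennreal (K powr (real k - a))" .
  have "ennreal ?p = (\<integral>\<^sup>+t. ennreal (exp (- t) * t ^ k / fact k) \<partial>interval_measure F)"
    by (rule nn_integral_poisson_pareto(1)[OF K a F, symmetric])
  also have "\<dots> = (\<integral>\<^sup>+x. ennreal (pareto_density K a x) * indicator {K..} x * ennreal (exp (- x) * x ^ k / fact k) \<partial>lborel)"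
    unfolding interval_measure_pareto_density[OF K a F] by (rule nn_integral_density) auto
  also have "\<dots> = (\<integral>\<^sup>+x. ennreal (a * K powr a / fact k) * (ennreal (g x) * indicator {K..} x) \<partial>lborel)"
  proof (rule nn_integral_cong)
    fix x
    show "ennreal (pareto_density K a x) * indicator {K..} x * ennreal (exp (- x) * x ^ k / fact k)
        = ennreal (a * K powr a / fact k) * (ennreal (g x) * indicator {K..} x)"
    proof (cases "K \<le> x")
      case True
      then have x: "0 < x" using K by simp
      have "x powr (- (a + 1)) * x ^ k = x powr (real k - a - 1)"
      proof -
        have "x powr (- (a + 1)) * x ^ k = x powr (- (a + 1) + real k)"
          by (simp only: powr_add powr_realpow[OF x])
        also have "- (a + 1) + real k = real k - a - 1"
          by simp
        finally show ?thesis .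
      qed
      then have "pareto_density K a x * (exp (- x) * x ^ k / fact k) = a * K powr a / fact k * g x"
        by (simp add: pareto_density_def g_def exp_minus field_simps)
      then show ?thesis
        using True a by (simp add: pareto_density_nonneg flip: ennreal_mult')
    qed simp
  qed
  also have "\<dots> = ennreal (a * K powr a / fact k) * B"
    unfolding B_def by (rule nn_integral_cmult) measurable
  finally have p: "ennreal ?p = ennreal (a * K powr a / fact k) * B" .
  \<comment> \<open>The sum of both pieces is a finite Gamma value, so the identities pass from
    \<open>ennreal\<close> to the reals.\<close>
  have "B \<noteq> \<top>" using AB by (metis ennreal_add_eq_top ennreal_neq_top)
  then obtain b where b: "B = ennreal b" "0 \<le> b" by (cases B) auto
  have "A \<noteq> \<top>" using AB by (metis ennreal_add_eq_top ennreal_neq_top)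
  then obtain e where e: "A = ennreal e" "0 \<le> e" by (cases A) auto
  have "e \<le> K powr (real k - a)"
    using A e by simp
  moreover have "Gamma (real k - a) = e + b"
    using AB b e Gamma_real_pos[of "real k - a"] k by (simp flip: ennreal_plus)
  moreover have "?p = a * K powr a / fact k * b"
    using p b a nn_integral_poisson_pareto(2)[OF K a F, of k] by (simp flip: ennreal_mult')
  ultimately show ?thesis
    using a e b by (auto intro!: mult_left_mono divide_right_mono)
qed

text \<open>After division by the claimed order the weights are squeezed between a Gamma quotient
  tending to 1 and the same quotient minus the correction for the cut-off at \<open>K\<close>, which
  tends to 0 because factorials outgrow powers.\<close>

lemma poisson_pareto_asymp_equiv:
  assumes K: "0 < K" and a: "0 < a"
    and F: "\<And>t. F t = (if K \<le> t then 1 - (K / t) powr a else 0)"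
  shows "(\<lambda>k. LINT t|interval_measure F. exp (- t) * t ^ k / fact k)
           \<sim>[sequentially] (\<lambda>k. a * K powr a * real k powr (- (a + 1)))"
proof (rule asymp_equivI')
  let ?p = "\<lambda>k. LINT t|interval_measure F. exp (- t) * t ^ k / fact k"
  let ?G = "\<lambda>k. Gamma (real k - a) / fact k * real k powr (a + 1)"
  let ?E = "\<lambda>k. K powr (real k - a) / fact k * real k powr (a + 1)"
  have E: "?E \<longlonglongrightarrow> 0"
  proof (rule tendsto_sandwich)
    show "\<forall>\<^sub>F k in sequentially. 0 \<le> ?E k" by simp
    \<comment> \<open>Trading the power of \<open>k\<close> for \<open>2 ^ k\<close> bounds
      \<open>?E\<close> by multiples of the terms of the exponential series at
      \<open>2 * K\<close>.\<close>
    have "\<forall>\<^sub>F k in sequentially. real k powr (a + 1) \<le> 2 ^ k"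
      using a by real_asymp
    then show "\<forall>\<^sub>F k in sequentially. ?E k \<le> K powr (- a) * (inverse (fact k) * (2 * K) ^ k)"
    proof eventually_elim
      case (elim k)
      then have "?E k \<le> K powr (real k - a) / fact k * 2 ^ k"
        by (intro mult_left_mono) auto
      also have "\<dots> = K powr (- a) * (inverse (fact k) * (2 * K) ^ k)"
        using K by (simp add: powr_diff powr_realpow powr_minus divide_inverse power_mult_distrib)
      finally show ?case .
    qed
    have "(\<lambda>k. K powr (- a) * (inverse (fact k) * (2 * K) ^ k)) \<longlonglongrightarrow> K powr (- a) * 0"
      by (intro tendsto_intros summable_LIMSEQ_zero summable_exp)
    then show "(\<lambda>k. K powr (- a) * (inverse (fact k) * (2 * K) ^ k)) \<longlonglongrightarrow> 0" by simp
  qed simp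
  have G: "?G \<longlonglongrightarrow> 1"
    by (rule Gamma_fact_ratio_tendsto[OF a])
  have large: "\<forall>\<^sub>F k in sequentially. 0 < real k \<and> a + 1 \<le> real k"
    by (intro eventually_conj) real_asymp+
  have eq: "?p k / (a * K powr a * real k powr (- (a + 1))) = ?p k / (a * K powr a) * real k powr (a + 1)" for k
    by (simp only: powr_minus divide_inverse inverse_mult_distrib inverse_inverse_eq mult.assoc)
  show "(\<lambda>k. ?p k / (a * K powr a * real k powr (- (a + 1)))) \<longlonglongrightarrow> 1"
    unfolding eq
  proof (rule tendsto_sandwich)
    show "\<forall>\<^sub>F k in sequentially. ?G k - ?E k \<le> ?p k / (a * K powr a) * real k powr (a + 1)"
      using large
    proof eventually_elim
      case (elim k)
      have "(Gamma (real k - a) - K powr (real k - a)) / fact k \<le> ?p k / (a * K powr a)"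
        using poisson_pareto_between[OF K a F, of k] elim K a by (simp add: field_simps)
      then have "(Gamma (real k - a) - K powr (real k - a)) / fact k * real k powr (a + 1)
          \<le> ?p k / (a * K powr a) * real k powr (a + 1)"
        by (rule mult_right_mono) simp
      then show ?case by (simp add: diff_divide_distrib left_diff_distrib)
    qed
    show "\<forall>\<^sub>F k in sequentially. ?p k / (a * K powr a) * real k powr (a + 1) \<le> ?G k"
      using large
    proof eventually_elim
      case (elim k)
      have "?p k / (a * K powr a) \<le> Gamma (real k - a) / fact k"
        using poisson_pareto_between[OF K a F, of k] elim K a by (simp add: field_simps)
      then show ?case by (rule mult_right_mono) simp
    qed
    show "(\<lambda>k. ?G k - ?E k) \<longlonglongrightarrow> 1"
      using tendsto_diff[OF G E] by simp
  qed (rule G)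
qed

section \<open>Convergence of the degree distribution\<close>

text \<open>The power law appears in two forms. In the joint limit both terms tend to 0, so the
  additive error compares small quantities; the asymptotic equivalence for the limit weights
  \<open>p\<close> fixes the exponent and the constant.\<close>

theorem theorem1p1:
  fixes \<zeta> \<alpha> \<beta> K :: real and F :: "real \<Rightarrow> real" and u :: "nat \<Rightarrow> nat"
  assumes zeta: "0 < \<zeta>" "\<zeta> < 2"
    and alpha: "0 < \<alpha>"
    and beta: "1 < \<beta>"
    and ratio: "0 < \<zeta> / \<alpha>" "\<zeta> / \<alpha> < 2"
    and vertex: "\<And>N. 1 \<le> N \<Longrightarrow> u N < N"
    and K: "K = 4 * \<alpha> / (2 * \<alpha> - \<zeta>) * (1 / \<beta>) * (1 / sin (pi / \<beta>))"
    and F: "\<And>t. F t = (if K \<le> t then 1 - (K / t) powr (2 * \<alpha> / \<zeta>) else 0)"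
  shows "weak_conv_m
           (\<lambda>N. distr (hyp_graph \<zeta> \<alpha> \<beta> N) borel (\<lambda>g. real (vertex_degree N (u N) g)))
           (distr (mixed_poisson F) borel real) \<and>
         ((\<lambda>(k, N). \<P>(g in hyp_graph \<zeta> \<alpha> \<beta> N. vertex_degree N (u N) g = k)
             - 2 * \<alpha> / \<zeta> * K powr (2 * \<alpha> / \<zeta>) * real k powr (- (2 * \<alpha> / \<zeta> + 1)))
           \<longlongrightarrow> 0) (sequentially \<times>\<^sub>F sequentially) \<and>
         (\<exists>p :: nat \<Rightarrow> real.
           (\<forall>k. (\<lambda>N. \<P>(g in hyp_graph \<zeta> \<alpha> \<beta> N. vertex_degree N (u N) g = k)) \<longlonglongrightarrow> p k) \<and>
           p \<sim>[sequentially]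
             (\<lambda>k. 2 * \<alpha> / \<zeta> * K powr (2 * \<alpha> / \<zeta>) * real k powr (- (2 * \<alpha> / \<zeta> + 1))))"
proof -
  define a where "a = 2 * \<alpha> / \<zeta>"
  have a: "0 < a"
    using zeta alpha by (simp add: a_def)
  have ratio': "\<zeta> < 2 * \<alpha>"
    using ratio alpha by (simp add: field_simps)
  have "0 < sin (pi / \<beta>)"
    using beta by (intro sin_gt_zero) (auto simp: field_simps)
  then have K0: "0 < K"
    unfolding K using alpha beta ratio' by simp
  note F' = F[folded a_def]
  let ?H = "\<lambda>N. hyp_graph \<zeta> \<alpha> \<beta> N"
  let ?deg = "\<lambda>N. vertex_degree N (u N)"
  define p where "p k = (LINT t|interval_measure F. exp (- t) * t ^ k / fact k)" for k
  define P where "P N k = measure (?H N) {g. ?deg N g = k}" for N k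
  have space: "space (?H N) = UNIV" for N
    using sets_eq_imp_space_eq[of "?H N" "count_space UNIV"] by simp
  have prob: "prob_space (?H N)" if "2 \<le> N" for N
    by (rule prob_space_hyp_graph[OF zeta(1) alpha that])
  have p_nonneg: "0 \<le> p k" for k
    unfolding p_def by (rule nn_integral_poisson_pareto(2)[OF K0 a F'])
  have lim_P: "(\<lambda>N. P N k) \<longlonglongrightarrow> p k" for k
  proof -
    have "(\<lambda>N. emeasure (?H N) {g. ?deg N g = k})
        \<longlonglongrightarrow> (\<integral>\<^sup>+t. ennreal (exp (- (K * exp (\<zeta> * t / 2))) * (K * exp (\<zeta> * t / 2)) ^ k / fact k)
              \<partial>density lborel (exponential_density \<alpha>))"
      unfolding K by (rule tendsto_emeasure_vertex_degree[OF zeta(1) alpha beta ratio' vertex])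
    \<comment> \<open>The map from depth to mean degree pushes the exponential law forward to the
      Pareto mixing law.\<close>
    also have "(\<integral>\<^sup>+t. ennreal (exp (- (K * exp (\<zeta> * t / 2))) * (K * exp (\<zeta> * t / 2)) ^ k / fact k)
              \<partial>density lborel (exponential_density \<alpha>))
        = (\<integral>\<^sup>+t. ennreal (exp (- t) * t ^ k / fact k) \<partial>interval_measure F)"
      unfolding interval_measure_pareto_exponential[OF zeta(1) alpha K0 F]
      by (subst nn_integral_distr) auto
    also have "\<dots> = ennreal (p k)"
      unfolding p_def by (rule nn_integral_poisson_pareto(1)[OF K0 a F'])
    finally have "(\<lambda>N. emeasure (?H N) {g. ?deg N g = k}) \<longlonglongrightarrow> ennreal (p k)" .
    moreover have "emeasure (?H N) {g. ?deg N g = k} = ennreal (P N k)" if "2 \<le> N" for N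
      unfolding P_def using prob[OF that]
      by (intro finite_measure.emeasure_eq_measure) (rule prob_space.finite_measure)
    ultimately have "(\<lambda>N. ennreal (P N k)) \<longlonglongrightarrow> ennreal (p k)"
      by (rule Lim_transform_eventually[OF _ eventually_mono[OF eventually_ge_at_top[of 2]]])
    then show ?thesis
      using p_nonneg by (subst (asm) tendsto_ennreal_iff) (auto simp: P_def)
  qed
  have finite_sum: "measure (?H N) {g. ?deg N g \<in> S} = (\<Sum>k\<in>S. P N k)" if "2 \<le> N" "finite S" for N S
  proof -
    interpret prob_space "?H N" by (rule prob[OF that(1)])
    have "{g. ?deg N g \<in> S} = (\<Union>k\<in>S. {g. ?deg N g = k})" by auto
    then show ?thesis
      using that unfolding P_def
      by (simp, intro finite_measure_finite_Union) (auto simp: disjoint_family_on_def)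
  qed
  have p_asymp: "p \<sim>[sequentially] (\<lambda>k. a * K powr a * real k powr (- (a + 1)))"
    unfolding p_def by (rule poisson_pareto_asymp_equiv[OF K0 a F'])

  have weak: "weak_conv_m (\<lambda>N. distr (?H N) borel (\<lambda>g. real (?deg N g))) (distr (mixed_poisson F) borel real)"
    unfolding weak_conv_m_def weak_conv_def
  proof (intro allI impI)
    fix x
    \<comment> \<open>Degrees are natural numbers, so each value of the distribution function is a
      finite sum of point masses and converges termwise.\<close>
    define S where "S = {k. real k \<le> x}"
    have S: "finite S"
      unfolding S_def by (rule finite_subset[of _ "{..nat \<lfloor>x\<rfloor>}"]) (auto simp: le_nat_floor)
    have "cdf (distr (mixed_poisson F) borel real) x = measure (mixed_poisson F) S"
      by (simp add: cdf_def measure_distr mixed_poisson_def S_def vimage_def)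
    also have "\<dots> = (\<Sum>k\<in>S. p k)"
    proof -
      have "emeasure (mixed_poisson F) S = (\<Sum>k\<in>S. ennreal (p k))"
        using S by (simp add: mixed_poisson_def p_def emeasure_density nn_integral_count_space_indicator[symmetric]
            nn_integral_count_space_finite)
      also have "\<dots> = ennreal (\<Sum>k\<in>S. p k)"
        using p_nonneg by (simp add: sum_ennreal)
      finally show ?thesis
        using p_nonneg by (simp add: measure_def sum_nonneg)
    qed
    finally have cdf_limit: "cdf (distr (mixed_poisson F) borel real) x = (\<Sum>k\<in>S. p k)" .
    have cdf_N: "(\<Sum>k\<in>S. P N k) = cdf (distr (?H N) borel (\<lambda>g. real (?deg N g))) x" if "2 \<le> N" for N
      using finite_sum[OF that S]
      by (simp add: cdf_def measure_distr space S_def vimage_def measurable_def)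
    have "(\<lambda>N. \<Sum>k\<in>S. P N k) \<longlonglongrightarrow> (\<Sum>k\<in>S. p k)"
      by (intro tendsto_sum lim_P)
    then show "(\<lambda>N. cdf (distr (?H N) borel (\<lambda>g. real (?deg N g))) x) \<longlonglongrightarrow> cdf (distr (mixed_poisson F) borel real) x"
      unfolding cdf_limit
      by (rule Lim_transform_eventually[OF _ eventually_mono[OF eventually_ge_at_top[of 2] cdf_N]])
  qed

  have uniform: "((\<lambda>(k, N). P N k - a * K powr a * real k powr (- (a + 1))) \<longlongrightarrow> 0) (sequentially \<times>\<^sub>F sequentially)"
  proof (rule tendstoI)
    fix e :: real assume e: "0 < e"
    \<comment> \<open>Tightness: \<open>n\<close> is chosen so that the limit weights below it carry
      more than \<open>1 - e / 2\<close>. For large \<open>N\<close> so do the degree probabilities,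
      which leaves less than \<open>e / 2\<close> for any single \<open>k \<ge> n\<close>, uniformly
      in \<open>k\<close>.\<close>
    have "(\<lambda>n. \<Sum>k<n. p k) \<longlonglongrightarrow> 1"
      using poisson_pareto_sums[OF K0 a F'] by (simp add: sums_def p_def)
    then have "\<forall>\<^sub>F n in sequentially. 1 - e / 2 < (\<Sum>k<n. p k)"
      using e by (intro order_tendstoD) auto
    then obtain n where n: "1 - e / 2 < (\<Sum>k<n. p k)"
      by (auto simp: eventually_sequentially)
    have "(\<lambda>N. \<Sum>k<n. P N k) \<longlonglongrightarrow> (\<Sum>k<n. p k)"
      by (intro tendsto_sum lim_P)
    from order_tendstoD(1)[OF this n]
    have evN: "\<forall>\<^sub>F N in sequentially. 2 \<le> N \<and> 1 - e / 2 < (\<Sum>k<n. P N k)"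
      using eventually_ge_at_top[of 2] by eventually_elim auto
    have "(\<lambda>k. a * K powr a * real k powr (- (a + 1))) \<longlonglongrightarrow> 0"
      using a by real_asymp
    then have "\<forall>\<^sub>F k in sequentially. a * K powr a * real k powr (- (a + 1)) < e / 2"
      using e by (intro order_tendstoD) auto
    then have evk: "\<forall>\<^sub>F k in sequentially. n \<le> k \<and> a * K powr a * real k powr (- (a + 1)) < e / 2"
      using eventually_ge_at_top[of n] by eventually_elim auto
    show "\<forall>\<^sub>F x in sequentially \<times>\<^sub>F sequentially.
        dist ((\<lambda>(k, N). P N k - a * K powr a * real k powr (- (a + 1))) x) 0 < e"
      unfolding eventually_prod_filter
    proof (intro exI conjI allI impI, rule evk, rule evN)
      fix k N
      assume k: "n \<le> k \<and> a * K powr a * real k powr (- (a + 1)) < e / 2"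
        and N: "2 \<le> N \<and> 1 - e / 2 < (\<Sum>k<n. P N k)"
      interpret prob_space "?H N" using N by (intro prob) simp
      have "P N k + (\<Sum>k<n. P N k) = (\<Sum>k\<in>insert k {..<n}. P N k)"
        using k by simp
      also have "\<dots> = prob {g. ?deg N g \<in> insert k {..<n}}"
        using N by (intro finite_sum[symmetric]) auto
      also have "\<dots> \<le> 1"
        by (rule prob_le_1)
      finally have "P N k < e / 2"
        using N by linarith
      moreover have "0 \<le> P N k" "0 \<le> a * K powr a * real k powr (- (a + 1))"
        using a by (auto simp: P_def)
      ultimately show "dist ((\<lambda>(k, N). P N k - a * K powr a * real k powr (- (a + 1))) (k, N)) 0 < e"
        using k by (auto simp: dist_real_def abs_less_iff)
    qed
  qed
  have "P N k = \<P>(g in ?H N. ?deg N g = k)" for N k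
    by (simp add: P_def space)
  then show ?thesis
    using weak uniform p_asymp lim_P unfolding a_def by auto
qed

end
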